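(* For every $n$, every $k:=k(n)<n$ and every $\delta:=\delta(n)>0$, there is a bounded-error randomized algorithm that distinguishes (i) $n$-vertex graphs that contain a $k$-clique from (ii) $n$-vertex graphs all of whose $k$-vertex subgraphs contain at most $(1-\delta)\binom{k}{2}$ edges, by inspecting only the induced subgraph $G[S]$ of the input graph $G$ on a uniformly random set $S$ of $|S| = O\!\left(\frac{n}{\delta^2 k}\ln^3\!\left(\frac{n}{\delta^2 k}\right)\right)$ vertices.
   Context: Graphs are simple and undirected. A bounded-error randomized algorithm here means there are absolute constants $\delta_1>\delta_2$ such that every graph of type (i) is accepted with probability at least $\delta_1$ and every graph of type (ii) is accepted with probability at most $\delta_2$. The constant in the $O(\cdot)$ is absolute.
   Formalization: Assumes k ≥ 2 (for k = 1 every graph is of both types; for k = 0 the bound is undefined), and reads the sample size as C·max(1, x ln³ x) with x = n/(δ²k), since x ln³ x tends to 0 as x → 1 and is negative for x < 1. *)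

theory Defs
  imports "HOL-Probability.Probability" "HOL-Library.Ramsey"
begin

definition simple_graph :: "'a set \<Rightarrow> 'a set set \<Rightarrow> bool" where
  "simple_graph V E \<longleftrightarrow> finite V \<and> E \<subseteq> [V]\<^bsup>2\<^esup>"

definition is_subgraph :: "'a set \<Rightarrow> 'a set set \<Rightarrow> 'a set \<Rightarrow> 'a set set \<Rightarrow> bool" where
  "is_subgraph W F V E \<longleftrightarrow> simple_graph W F \<and> W \<subseteq> V \<and> F \<subseteq> E"

definition induced_edges :: "'a set set \<Rightarrow> 'a set \<Rightarrow> 'a set set" where
  "induced_edges E S = {e \<in> E. e \<subseteq> S}"

definition has_clique :: "'a set \<Rightarrow> 'a set set \<Rightarrow> nat \<Rightarrow> bool" where
  "has_clique V E k \<longleftrightarrow> (\<exists>K\<in>[V]\<^bsup>k\<^esup>. clique K E)"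

definition sparse_subgraphs :: "'a set \<Rightarrow> 'a set set \<Rightarrow> nat \<Rightarrow> real \<Rightarrow> bool" where
  "sparse_subgraphs V E k \<delta> \<longleftrightarrow>
     (\<forall>W F. is_subgraph W F V E \<and> card W = k \<longrightarrow> real (card F) \<le> (1 - \<delta>) * real (k choose 2))"

text \<open>
  A randomized algorithm is modelled by the distribution of its verdict (\<^term>\<open>True\<close> is
  acceptance) as a function of what it inspects. Its only access to the input graph is the induced
  subgraph on the sampled set, so its arguments are the vertex set and the edge set of that
  subgraph.
\<close>

type_synonym 'a sample_algorithm = "'a set \<Rightarrow> 'a set set \<Rightarrow> bool pmf"

text \<open>
  The probability is over both the uniformly random \<open>s\<close>-element set of vertices and the internal
  coins of the algorithm. It is meaningful only for finite \<open>V\<close> and \<open>s \<le> card V\<close>, since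
  otherwise there is no uniform distribution on the \<open>s\<close>-element subsets.
\<close>

definition acceptance_prob ::
    "'a sample_algorithm \<Rightarrow> nat \<Rightarrow> 'a set \<Rightarrow> 'a set set \<Rightarrow> real" where
  "acceptance_prob A s V E =
     pmf (do { S \<leftarrow> pmf_of_set ([V]\<^bsup>s\<^esup>); A S (induced_edges E S) }) True"

text \<open>
  The absolute-constant reading of \<open>O(x ln\<^sup>3 x)\<close> with \<open>x = n / (\<delta>\<^sup>2 k)\<close>. The maximum with 1
  matters only for bounded \<open>x\<close>: as \<open>x\<close> tends to 1 the logarithm vanishes (take \<open>\<delta> = 1\<close> and
  \<open>k = n - 1\<close>), and for \<open>x < 1\<close> it is negative, so that no sample of two vertices would be
  allowed at all. For \<open>x \<ge> 2\<close> it changes the bound by at most a constant factor.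
\<close>

definition sample_bound :: "nat \<Rightarrow> nat \<Rightarrow> real \<Rightarrow> real" where
  "sample_bound n k \<delta> =
     (let x = real n / (\<delta>\<^sup>2 * real k) in max 1 (x * (ln x) ^ 3))"

end

theory Submission
  imports Defs
begin

text \<open>
  The test accepts when the sample contains a clique of almost the expected size \<open>s k / n\<close> of its
  intersection with a \<open>k\<close>-clique; Chebyshev's inequality handles graphs with a \<open>k\<close>-clique. For the
  other graphs, cliques are independent sets of the complement, and the graph container method
  applies: running through the vertices by decreasing degree, an independent set is determined up to
  a container by a small fingerprint. If every \<open>k\<close>-set spans a \<open>\<delta>\<close>-fraction of the pairs, a fingerprint
  of size \<open>f\<close> comes with a container of at most \<open>(1 - \<gamma>) k\<close> vertices, where \<open>\<gamma>\<close> is of order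
  \<open>\<delta> (f + 1) / ln (n / (\<delta>\<^sup>2 k))\<close>. That the gain grows with \<open>f\<close> is the crucial point: the Chernoff
  exponent \<open>\<gamma>\<^sup>2 s k / n\<close> then beats the \<open>s\<^sup>f\<close> choices of the fingerprint inside the sample for all
  \<open>f\<close> simultaneously, at the cost \<open>1 / \<delta>\<^sup>2\<close> instead of \<open>1 / \<delta>\<^sup>3\<close> in the sample size.
\<close>

section \<open>Graph containers\<close>

text \<open>It is instantiated with non-adjacency of distinct vertices, so that its independent sets
  are the cliques of the input graph.\<close>

locale loopless_graph =
  fixes V :: "'a set" and R :: "'a \<Rightarrow> 'a \<Rightarrow> bool"
  assumes finite_V: "finite V"
    and sym: "R u v \<Longrightarrow> R v u"
    and irrefl: "\<not> R v v"
begin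

section \<open>Degree sums and completion by low-degree vertices\<close>

definition deg :: "'a set \<Rightarrow> 'a \<Rightarrow> nat" where
  "deg C v = card {u \<in> C. R v u}"

text \<open>For \<open>C \<subseteq> V\<close> this counts ordered adjacent pairs, hence every edge
  inside \<open>C\<close> twice; densities are therefore measured against
  \<open>k\<^sup>2\<close>.\<close>

definition degsum :: "'a set \<Rightarrow> nat" where
  "degsum C = (\<Sum>v\<in>C. deg C v)"

lemma finite_sub: "C \<subseteq> V \<Longrightarrow> finite C"
  using finite_V finite_subset by blast

lemma deg_mono: "C \<subseteq> D \<Longrightarrow> D \<subseteq> V \<Longrightarrow> deg C v \<le> deg D v"
  unfolding deg_def using finite_sub by (intro card_mono) auto

lemma deg_le_card: "C \<subseteq> V \<Longrightarrow> deg C v \<le> card C"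
  unfolding deg_def using finite_sub by (intro card_mono) auto

lemma deg_eq_sum: "C \<subseteq> V \<Longrightarrow> deg C v = (\<Sum>u\<in>C. if R v u then 1 else 0)"
  unfolding deg_def using finite_sub[of C] by (simp add: sum.If_cases Int_def)

lemma sum_deg_swap:
  assumes "C \<subseteq> V" "D \<subseteq> V"
  shows "(\<Sum>v\<in>C. deg D v) = (\<Sum>u\<in>D. deg C u)"
proof -
  have "(\<Sum>v\<in>C. deg D v) = (\<Sum>v\<in>C. \<Sum>u\<in>D. if R v u then 1 else 0)"
    using assms by (simp add: deg_eq_sum)
  also have "\<dots> = (\<Sum>u\<in>D. \<Sum>v\<in>C. if R v u then 1 else 0)"
    by (rule sum.swap)
  also have "\<dots> = (\<Sum>u\<in>D. \<Sum>v\<in>C. if R u v then 1 else 0)"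
    using sym by (intro sum.cong refl) metis
  finally show ?thesis using assms by (simp add: deg_eq_sum)
qed

lemma degsum_insert:
  assumes "insert v W \<subseteq> V" "v \<notin> W"
  shows "degsum (insert v W) = degsum W + 2 * deg W v"
proof -
  have W: "W \<subseteq> V" "finite W" using assms finite_sub by auto
  have d: "deg (insert v W) u = (if R u v then 1 else 0) + deg W u" for u
    using assms W by (simp add: deg_eq_sum)
  have "(\<Sum>u\<in>W. if R u v then 1 else 0) = deg W v"
    using W sym by (subst deg_eq_sum) (auto intro!: sum.cong)
  then show ?thesis
    unfolding degsum_def using assms W irrefl by (simp add: d sum.distrib)
qed

text \<open>Double counting between \<open>W\<close> and \<open>B - W\<close>: vertices of
  \<open>W\<close> have degree at most \<open>card B / q\<close>, and if \<open>card B\<close> is at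
  least \<open>2 * k\<close>, then \<open>B - W\<close> holds more than half of \<open>B\<close>, so
  an average vertex there has at most \<open>2 * k / q\<close> neighbours in \<open>W\<close>. In a
  smaller \<open>B\<close> all degrees are small enough.\<close>

lemma low_degree_vertex:
  fixes q :: real
  assumes B: "B \<subseteq> V" and W: "W \<subseteq> B" "card W < k" "k \<le> card B" and q: "q > 0"
    and D: "\<And>v. v \<in> B \<Longrightarrow> q * deg B v \<le> card B"
  shows "\<exists>v\<in>B - W. q * deg W v \<le> 2 * k"
proof -
  have fin: "finite B" "finite W" using B W finite_sub by auto
  have BW: "B - W \<noteq> {}" using W fin by (metis Diff_eq_empty_iff card_mono leD le_trans)
  show ?thesis
  proof (cases "card B < 2 * k")
    case True
    obtain v where v: "v \<in> B - W" using BW by auto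
    have "q * deg W v \<le> q * deg B v" using q deg_mono[OF W(1) B] by simp
    also have "\<dots> \<le> card B" using D v by auto
    also have "\<dots> \<le> 2 * k" using True by simp
    finally show ?thesis using v by blast
  next
    case False
    show ?thesis
    proof (rule ccontr)
      assume "\<not> ?thesis"
      then have *: "real (2 * k) < q * deg W v" if "v \<in> B - W" for v using that by force
      have "real (2 * k) * card (B - W) = (\<Sum>v\<in>B - W. real (2 * k))" by simp
      also have "\<dots> < (\<Sum>v\<in>B - W. q * deg W v)"
        using BW fin * by (intro sum_strict_mono) auto
      also have "\<dots> = q * real (\<Sum>v\<in>B - W. deg W v)" by (simp add: sum_distrib_left)
      also have "(\<Sum>v\<in>B - W. deg W v) = (\<Sum>w\<in>W. deg (B - W) w)"
        using B W by (intro sum_deg_swap) auto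
      also have "q * real \<dots> = (\<Sum>w\<in>W. q * deg (B - W) w)" by (simp add: sum_distrib_left)
      also have "\<dots> \<le> (\<Sum>w\<in>W. real (card B))"
      proof (intro sum_mono)
        fix w assume w: "w \<in> W"
        have "q * deg (B - W) w \<le> q * deg B w" using q deg_mono[of "B - W" B w] B by simp
        then show "q * deg (B - W) w \<le> card B" using D[of w] w W by auto
      qed
      also have "\<dots> \<le> real k * card B" using W by (simp add: mult_right_mono)
      finally have "real (2 * k) * card (B - W) < real k * card B" .
      then have "2 * k * card (B - W) < k * card B" by (metis of_nat_less_iff of_nat_mult)
      then have "k * (2 * card (B - W)) < k * card B" by (simp add: ac_simps)
      then have "2 * card (B - W) < card B" by simp
      moreover have "card (B - W) = card B - card W" using W fin by (simp add: card_Diff_subset)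
      ultimately show False using False W by linarith
    qed
  qed
qed

text \<open>Completing \<open>A\<close> to \<open>k\<close> vertices of \<open>B\<close> by low-degree vertices adds few edges.\<close>

lemma degsum_lower_bound:
  fixes q \<epsilon> :: real
  assumes B: "B \<subseteq> V" "k \<le> card B" and q: "q > 0"
    and D: "\<And>v. v \<in> B \<Longrightarrow> q * deg B v \<le> card B"
    and dense: "\<And>W. W \<subseteq> V \<Longrightarrow> card W = k \<Longrightarrow> \<epsilon> * (real k)\<^sup>2 \<le> degsum W"
    and A: "A \<subseteq> B" "card A \<le> k"
  shows "\<epsilon> * (real k)\<^sup>2 \<le> degsum A + 4 * (real k - card A) * k / q"
  using A
proof (induction "k - card A" arbitrary: A)
  case 0
  then have "card A = k" "A \<subseteq> V" using B by auto
  then show ?case using dense[of A] by simp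
next
  case (Suc p)
  have fin: "finite A" using Suc B finite_sub by auto
  have lt: "card A < k" using Suc.hyps by linarith
  \<comment> \<open>One added vertex raises the degree sum by at most \<open>4 * k / q\<close>,
    exactly the drop of the error term when \<open>card A\<close> grows by one.\<close>
  obtain v where v: "v \<in> B - A" "q * deg A v \<le> 2 * k"
    using low_degree_vertex[OF B(1) Suc.prems(1) lt B(2) q D] by blast
  have c: "card (insert v A) = Suc (card A)" using v fin by simp
  have "\<epsilon> * (real k)\<^sup>2 \<le> degsum (insert v A) + 4 * (real k - card (insert v A)) * k / q"
    using Suc.hyps Suc.prems v lt c by (intro Suc.hyps(1)) auto
  moreover have "degsum (insert v A) = degsum A + 2 * deg A v"
    using v Suc.prems B by (intro degsum_insert) auto
  moreover have "real (deg A v) \<le> 2 * k / q" using v q by (simp add: field_simps)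
  ultimately show ?case using c q by (simp add: field_simps)
qed

text \<open>Ties are broken by a choice that depends on \<open>C\<close> alone and not on
  \<open>I\<close>; this is what lets a run be replayed from its fingerprint.\<close>

definition pick :: "'a set \<Rightarrow> 'a" where
  "pick C = (SOME v. v \<in> C \<and> (\<forall>u\<in>C. deg C u \<le> deg C v))"

lemma pick:
  assumes "C \<subseteq> V" "C \<noteq> {}"
  shows "pick C \<in> C" "u \<in> C \<Longrightarrow> deg C u \<le> deg C (pick C)"
proof -
  have fin: "finite C" using assms finite_sub by auto
  have "Max (deg C ` C) \<in> deg C ` C" using fin assms by (intro Max_in) auto
  then obtain v where "v \<in> C" "deg C v = Max (deg C ` C)" by auto
  then have "\<exists>v. v \<in> C \<and> (\<forall>u\<in>C. deg C u \<le> deg C v)"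
    using fin by (intro exI[of _ v]) auto
  then have "pick C \<in> C \<and> (\<forall>u\<in>C. deg C u \<le> deg C (pick C))"
    unfolding pick_def by (rule someI_ex)
  then show "pick C \<in> C" "u \<in> C \<Longrightarrow> deg C u \<le> deg C (pick C)" by auto
qed

lemma degsum_le_pick:
  assumes "C \<subseteq> V"
  shows "degsum C \<le> card C * deg C (pick C)"
proof (cases "C = {}")
  case False
  then show ?thesis
    unfolding degsum_def using pick[OF assms False] sum_bounded_above[of C "deg C"] by simp
qed (simp add: degsum_def)

text \<open>The greedy container algorithm: the first component is the fingerprint of \<open>I\<close>, the second
  one contains the rest of \<open>I\<close> when \<open>I\<close> is independent.\<close>

fun step :: "'a set \<Rightarrow> 'a set \<times> 'a set \<Rightarrow> 'a set \<times> 'a set" where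
  "step I (F, C) =
     (if C = {} then (F, C)
      else if pick C \<in> I then (insert (pick C) F, {u \<in> C. u \<noteq> pick C \<and> \<not> R (pick C) u})
      else (F, C - {pick C}))"

primrec run :: "'a set \<Rightarrow> nat \<Rightarrow> 'a set \<times> 'a set" where
  "run I 0 = ({}, V)"
| "run I (Suc i) = step I (run I i)"

definition fingerprint :: "'a set \<Rightarrow> nat \<Rightarrow> 'a set" where "fingerprint I i = fst (run I i)"
definition container :: "'a set \<Rightarrow> nat \<Rightarrow> 'a set" where "container I i = snd (run I i)"

section \<open>Invariants of a greedy run\<close>

lemma run_0 [simp]: "fingerprint I 0 = {}" "container I 0 = V"
  by (auto simp: fingerprint_def container_def)

lemma run_Suc:
  "fingerprint I (Suc i) =
     (if container I i \<noteq> {} \<and> pick (container I i) \<in> I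
      then insert (pick (container I i)) (fingerprint I i) else fingerprint I i)"
  "container I (Suc i) =
     (if container I i = {} then {}
      else if pick (container I i) \<in> I
        then {u \<in> container I i. u \<noteq> pick (container I i) \<and> \<not> R (pick (container I i)) u}
      else container I i - {pick (container I i)})"
  by (cases "run I i"; auto simp: fingerprint_def container_def)+

lemma container_subset: "container I i \<subseteq> V"
  by (induction i) (auto simp: run_Suc)

lemma fingerprint_subset: "fingerprint I i \<subseteq> I \<inter> V"
proof (induction i)
  case (Suc i)
  have "pick (container I i) \<in> V" if "container I i \<noteq> {}"
    using pick(1)[OF container_subset that] container_subset by blast
  then show ?case using Suc by (auto simp: run_Suc)
qed simp

lemma finite_run: "finite (fingerprint I i)" "finite (container I i)"
  using fingerprint_subset[of I i] container_subset[of I i] finite_sub by auto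

lemma fingerprint_disjoint: "fingerprint I i \<inter> container I i = {}"
  by (induction i) (auto simp: run_Suc)

lemma run_covers:
  assumes "I \<subseteq> V" "\<And>u v. u \<in> I \<Longrightarrow> v \<in> I \<Longrightarrow> \<not> R u v"
  shows "I \<subseteq> fingerprint I i \<union> container I i"
  using assms by (induction i) (auto simp: run_Suc)

lemma fingerprint_mono: "i \<le> j \<Longrightarrow> fingerprint I i \<subseteq> fingerprint I j"
  by (rule lift_Suc_mono_le) (auto simp: run_Suc)

lemma container_antimono: "i \<le> j \<Longrightarrow> container I j \<subseteq> container I i"
  by (rule lift_Suc_antimono_le) (auto simp: run_Suc)

lemma fingerprint_pick_notin: "container I i \<noteq> {} \<Longrightarrow> pick (container I i) \<notin> fingerprint I i"
  using pick(1)[OF container_subset] fingerprint_disjoint by blast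

lemma card_fingerprint_Suc:
  "card (fingerprint I i) \<le> card (fingerprint I (Suc i))"
  "card (fingerprint I (Suc i)) \<le> Suc (card (fingerprint I i))"
  using finite_run by (auto simp: run_Suc card_insert_if)

text \<open>A vertex that enters the fingerprint removes its neighbours from the container. The
  difference of cardinalities is 1 in such a step and 0 otherwise, so that one inequality covers
  both kinds of step.\<close>

lemma card_container_Suc:
  "card (container I (Suc i)) +
     (card (fingerprint I (Suc i)) - card (fingerprint I i)) * deg (container I i) (pick (container I i))
   \<le> card (container I i)"
proof (cases "container I i \<noteq> {} \<and> pick (container I i) \<in> I")
  case True
  define C where "C = container I i"
  have fin: "finite C" using finite_run C_def by auto
  have eq: "card (fingerprint I (Suc i)) = Suc (card (fingerprint I i))"
    using True fingerprint_pick_notin finite_run by (auto simp: run_Suc)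
  have "card {u \<in> C. u \<noteq> pick C \<and> \<not> R (pick C) u} + card {u \<in> C. R (pick C) u}
      = card ({u \<in> C. u \<noteq> pick C \<and> \<not> R (pick C) u} \<union> {u \<in> C. R (pick C) u})"
    using fin by (subst card_Un_disjoint) auto
  also have "\<dots> \<le> card C" using fin by (intro card_mono) auto
  finally show ?thesis using True eq by (simp add: run_Suc C_def deg_def)
next
  case False
  have "card (container I (Suc i)) \<le> card (container I i)"
    using container_antimono[of i "Suc i" I] finite_run by (intro card_mono) auto
  moreover have "fingerprint I (Suc i) = fingerprint I i" using False by (auto simp: run_Suc)
  ultimately show ?thesis by simp
qed

text \<open>A nonempty container loses the picked vertex in every step, so it is empty after
  \<open>card V\<close> steps; this supplies the stopping indices below.\<close>

lemma card_container_le: "card (container I i) \<le> card V - i"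
proof (induction i)
  case (Suc i)
  show ?case
  proof (cases "container I i = {}")
    case False
    have "container I (Suc i) \<subset> container I i"
      using False pick(1)[OF container_subset False] by (auto simp: run_Suc)
    then have "card (container I (Suc i)) < card (container I i)"
      using finite_run by (intro psubset_card_mono) auto
    then show ?thesis using Suc by linarith
  qed (simp add: run_Suc)
qed simp

text \<open>The algorithm cannot tell \<open>I\<close> from its fingerprint, so that the container is a function of the
  fingerprint.\<close>

lemma run_fingerprint:
  assumes "j \<le> i"
  shows "run (fingerprint I i) j = run I j"
  using assms
proof (induction j)
  case (Suc j)
  have eq: "run (fingerprint I i) j = run I j" using Suc by simp
  have "pick (container I j) \<in> fingerprint I i \<longleftrightarrow> pick (container I j) \<in> I"
    if "container I j \<noteq> {}"
    using that fingerprint_mono[OF Suc.prems, of I] fingerprint_subset[of I i]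
    by (auto simp: run_Suc split: if_splits)
  then show ?case using eq by (cases "run I j") (auto simp: container_def)
qed simp

text \<open>While the maximum degree exceeds a \<open>1 / q\<close> fraction of the container, each
  fingerprint vertex shrinks the container by a factor of at most
  \<open>1 - 1 / q \<le> exp (- 1 / q)\<close>.\<close>

lemma card_container_exp_decay:
  fixes q :: real
  assumes q: "q > 0"
    and D: "\<And>j. j < i \<Longrightarrow> card (container I j) < q * deg (container I j) (pick (container I j))"
  shows "card (container I i) \<le> card V * exp (- card (fingerprint I i) / q)"
  using D
proof (induction i)
  case (Suc i)
  define c c' f f' d where "c = card (container I i)" and "c' = card (container I (Suc i))"
    and "f = card (fingerprint I i)" and "f' = card (fingerprint I (Suc i))"
    and "d = deg (container I i) (pick (container I i))"
  have IH: "c \<le> card V * exp (- f / q)" unfolding c_def f_def using Suc by simp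
  have cd: "real c < q * d" unfolding c_def d_def using Suc.prems by simp
  have st: "c' + (f' - f) * d \<le> c" unfolding c_def c'_def f_def f'_def d_def
    by (rule card_container_Suc)
  consider "f' = f" | "f' = Suc f" using card_fingerprint_Suc[of I i] f_def f'_def by linarith
  then have "c' \<le> card V * exp (- f' / q)"
  proof cases
    case 1
    then show ?thesis using IH st by simp
  next
    case 2
    then have "c' + d \<le> c" using st by simp
    then have "real c' + d \<le> c" by linarith
    moreover have "c / q \<le> d" using cd q by (simp add: field_simps)
    ultimately have "c' \<le> c * (1 + (- 1 / q))" by (simp add: algebra_simps)
    also have "\<dots> \<le> c * exp (- 1 / q)" by (intro mult_left_mono exp_ge_add_one_self) auto
    also have "\<dots> \<le> (card V * exp (- f / q)) * exp (- 1 / q)" using IH by (intro mult_right_mono) auto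
    also have "\<dots> = card V * exp (- f' / q)"
      using 2 by (simp add: mult.assoc diff_divide_distrib flip: exp_add)
    finally show ?thesis .
  qed
  then show ?case by (simp add: c'_def f'_def)
qed simp

text \<open>If the algorithm needs \<open>t\<close> fingerprint vertices to reach size \<open>k\<close>, then some earlier
  container \<open>B\<close> had relative maximum degree \<open>O(\<Lambda> / t)\<close>. Replacing up to \<open>\<gamma> k\<close> vertices of a
  \<open>k\<close>-set by low-degree vertices of \<open>B\<close> creates few edges, so that the dense condition persists down
  to size \<open>(1 - \<gamma>) k\<close> with \<open>\<gamma>\<close> proportional to \<open>t\<close>.\<close>

lemma small_container_exists:
  fixes \<epsilon> \<Lambda> :: real
  assumes k: "0 < k" "k < card V" and \<epsilon>: "\<epsilon> > 0" and \<Lambda>: "\<Lambda> \<ge> 1" "ln (card V / k) \<le> \<Lambda>"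
    and dense: "\<And>W. W \<subseteq> V \<Longrightarrow> card W = k \<Longrightarrow> \<epsilon> * (real k)\<^sup>2 \<le> degsum W"
  shows "\<exists>i. card (container I i) \<le> (1 - \<epsilon> * (card (fingerprint I i) + 1) / (72 * \<Lambda>)) * k"
proof -
  define c where "c i = card (container I i)" for i
  define f where "f i = card (fingerprint I i)" for i
  define d where "d i = deg (container I i) (pick (container I i))" for i
  have st: "c (Suc i) + (f (Suc i) - f i) * d i \<le> c i" for i
    unfolding c_def f_def d_def by (rule card_container_Suc)
  have f_Suc: "f i \<le> f (Suc i)" "f (Suc i) \<le> Suc (f i)" for i
    unfolding f_def using card_fingerprint_Suc by auto
  have c_end: "c (card V) = 0" unfolding c_def using card_container_le[of I "card V"] by simp
  define T where "T = (LEAST i. c i \<le> k)"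
  have T: "c T \<le> k" unfolding T_def by (rule LeastI[of _ "card V"]) (simp add: c_end)
  have before_T: "k < c i" if "i < T" for i using not_less_Least that unfolding T_def by force
  have "c 0 = card V" by (simp add: c_def)
  then have "T \<noteq> 0" using T k by (metis leD)
  then obtain T1 where T1: "T = Suc T1" by (cases T) auto
  define t where "t = f T"
  have t1: "t \<le> f T1 + 1" unfolding t_def T1 using f_Suc[of T1] by simp
  \<comment> \<open>If the maximum degree exceeded a \<open>1 / q\<close> fraction throughout, the
    decay would allow fewer than \<open>q * \<Lambda>\<close>, a third of \<open>t + 1\<close>,
    fingerprint vertices before the last step. But there are at least \<open>t - 1\<close>, too many
    once \<open>t > 2\<close>.\<close>
  define q where "q = (real t + 1) / (3 * \<Lambda>)"
  have q: "q > 0" unfolding q_def using \<Lambda> by simp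
  have "\<exists>i0 < T. q * d i0 \<le> c i0"
  proof (rule ccontr)
    assume "\<not> ?thesis"
    then have *: "real (c i) < q * d i" if "i < T" for i using that by force
    \<comment> \<open>The first step excludes small \<open>t\<close>: a degree is at most
      \<open>card V\<close>, which forces \<open>q > 1\<close>.\<close>
    have "real (card V) < q * d 0" using *[of 0] T1 by (simp add: c_def)
    also have "\<dots> \<le> q * card V" using q deg_le_card[of V] by (simp add: d_def)
    finally have "1 < q" using k by simp
    then have "3 * \<Lambda> < real t + 1" unfolding q_def using \<Lambda> by (simp add: field_simps)
    then have t2: "t > 2" using \<Lambda> by linarith
    have "real k < c T1" using before_T T1 by simp
    also have "\<dots> \<le> card V * exp (- f T1 / q)"
      unfolding c_def f_def using * T1 q by (intro card_container_exp_decay) (auto simp: c_def d_def)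
    finally have "exp (f T1 / q) < card V / k"
      using k by (simp add: exp_minus field_simps)
    then have "ln (exp (f T1 / q)) < ln (card V / k)" using k by (subst ln_less_cancel_iff) auto
    then have "f T1 / q < ln (card V / k)" by simp
    then have "f T1 / q < \<Lambda>" using \<Lambda> by linarith
    then have "real (f T1) < q * \<Lambda>" using q by (simp add: field_simps)
    also have "\<dots> = (real t + 1) / 3" unfolding q_def using \<Lambda> by simp
    finally have "real (f T1) < (real t + 1) / 3" .
    moreover have "real t \<le> f T1 + 1" "real t > 2" using t1 t2 by linarith+
    ultimately show False by simp
  qed
  then obtain i0 where i0: "i0 < T" "q * d i0 \<le> c i0" by auto
  define B where "B = container I i0"
  have B: "B \<subseteq> V" "k \<le> card B"
    unfolding B_def using container_subset before_T[OF i0(1)] by (auto simp: c_def)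
  have DB: "q * deg B v \<le> card B" if "v \<in> B" for v
  proof -
    have "deg B v \<le> d i0" unfolding B_def d_def
      using that container_subset by (intro pick(2)) (auto simp: B_def)
    then have "q * deg B v \<le> q * d i0" using q by simp
    then show ?thesis using i0 by (simp add: B_def c_def)
  qed
  have lower: "\<epsilon> * (real k)\<^sup>2 \<le> degsum A + 4 * (real k - card A) * k / q"
    if "A \<subseteq> B" "card A \<le> k" for A
    by (rule degsum_lower_bound[OF B q DB dense that])
  \<comment> \<open>Chosen so that replacing \<open>\<gamma> * k\<close> vertices costs
    \<open>4 * \<gamma> * k\<^sup>2 / q\<close>, half of the guaranteed
    \<open>\<epsilon> * k\<^sup>2\<close>.\<close>
  define \<gamma> where "\<gamma> = \<epsilon> * q / 8"
  have "\<epsilon> * (real k)\<^sup>2 \<le> 4 * (real k)\<^sup>2 / q"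
    using lower[of "{}"] by (simp add: degsum_def power2_eq_square)
  then have "\<epsilon> * q \<le> 4" using k q by (simp add: field_simps)
  then have \<gamma>: "\<gamma> \<le> 1" "\<gamma> > 0" unfolding \<gamma>_def using \<epsilon> q by auto
  define T' where "T' = (LEAST i. c i \<le> (1 - \<gamma>) * k)"
  have T': "c T' \<le> (1 - \<gamma>) * k"
    unfolding T'_def by (rule LeastI[of _ "card V"]) (use \<gamma> c_end in auto)
  have before_T': "(1 - \<gamma>) * k < c i" if "i < T'" for i
    using not_less_Least[of i "\<lambda>i. c i \<le> (1 - \<gamma>) * k"] that unfolding T'_def by force
  have "(1 - \<gamma>) * k \<le> k" using \<gamma> k by (simp add: algebra_simps)
  then have "c T' \<le> k" using T' by linarith
  then have TT': "T \<le> T'" unfolding T_def by (rule Least_le)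
  \<comment> \<open>In this phase the container lies in \<open>B\<close> and has between
    \<open>(1 - \<gamma>) * k\<close> and \<open>k\<close> vertices, so half of the density survives
    and the picked vertex, having maximum degree, has degree at least
    \<open>\<epsilon> * k / 2\<close>.\<close>
  have d: "\<epsilon> * k / 2 \<le> d i" if "T \<le> i" "i < T'" for i
  proof -
    let ?A = "container I i"
    have AB: "?A \<subseteq> B" unfolding B_def using i0 that by (intro container_antimono) auto
    have "c i \<le> c T" unfolding c_def using that finite_run by (intro card_mono container_antimono) auto
    then have ck: "c i \<le> k" using T by simp
    have "real k - c i \<le> \<gamma> * k" using before_T'[OF that(2)] by (simp add: algebra_simps)
    then have "4 * (real k - c i) * k / q \<le> 4 * (\<gamma> * k) * k / q"
      using q by (intro divide_right_mono mult_right_mono mult_left_mono) auto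
    also have "\<dots> = \<epsilon> * (real k)\<^sup>2 / 2" unfolding \<gamma>_def using q by (simp add: power2_eq_square)
    finally have "\<epsilon> * (real k)\<^sup>2 / 2 \<le> degsum ?A"
      using lower[OF AB] ck by (simp add: c_def)
    also have "degsum ?A \<le> c i * d i"
      unfolding c_def d_def by (rule degsum_le_pick[OF container_subset])
    also have "\<dots> \<le> k * d i" using ck by simp
    finally have "(\<epsilon> * k / 2) * k \<le> d i * real k" by (simp add: power2_eq_square mult_ac)
    then show ?thesis using k by simp
  qed
  have inv: "c (T + j) + (real (f (T + j)) - t) * (\<epsilon> * k / 2) \<le> k" if "T + j \<le> T'" for j
    using that
  proof (induction j)
    case 0
    then show ?case using T by (simp add: t_def)
  next
    case (Suc j)
    have "(real (f (Suc (T + j))) - f (T + j)) * (\<epsilon> * k / 2) \<le>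
        (real (f (Suc (T + j))) - f (T + j)) * d (T + j)"
      using Suc.prems f_Suc[of "T + j"] by (intro mult_left_mono d) auto
    moreover have "real (c (Suc (T + j)) + (f (Suc (T + j)) - f (T + j)) * d (T + j)) \<le> c (T + j)"
      using st[of "T + j"] by (simp only: of_nat_le_iff)
    then have "c (Suc (T + j)) + (real (f (Suc (T + j))) - f (T + j)) * d (T + j) \<le> c (T + j)"
      using f_Suc[of "T + j"] by (simp add: of_nat_diff)
    moreover have "(real (f (Suc (T + j))) - t) * (\<epsilon> * k / 2) =
        (real (f (T + j)) - t) * (\<epsilon> * k / 2) + (real (f (Suc (T + j))) - f (T + j)) * (\<epsilon> * k / 2)"
      by (simp add: algebra_simps diff_divide_distrib)
    moreover have "c (T + j) + (real (f (T + j)) - t) * (\<epsilon> * k / 2) \<le> k" using Suc by simp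
    ultimately show ?case unfolding add_Suc_right by linarith
  qed
  \<comment> \<open>Each fingerprint vertex after \<open>T\<close> costs at least
    \<open>\<epsilon> * k / 2\<close> container vertices out of a supply of
    \<open>\<gamma> * k\<close>, so at most \<open>q / 4\<close> come before the last step, which
    may add one more.\<close>
  have f_end: "real (f T') + 1 \<le> 3 * (real t + 1)"
  proof (cases "T = T'")
    case True
    then show ?thesis by (simp add: t_def)
  next
    case False
    then obtain j where j: "T' = Suc (T + j)" using TT' by (metis le_neq_implies_less less_iff_Suc_add)
    have "(1 - \<gamma>) * k + (real (f (T + j)) - t) * (\<epsilon> * k / 2) \<le> k"
      using inv[of j] before_T'[of "T + j"] j by simp
    then have "k * ((real (f (T + j)) - t) * (\<epsilon> / 2)) \<le> k * \<gamma>" by (simp add: algebra_simps)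
    then have "(real (f (T + j)) - t) * (\<epsilon> / 2) \<le> \<gamma>" using k by simp
    then have "\<epsilon> * (real (f (T + j)) - t) \<le> \<epsilon> * (q / 4)" unfolding \<gamma>_def by (simp add: algebra_simps)
    then have "real (f (T + j)) - t \<le> q / 4" using \<epsilon> by (simp only: mult_le_cancel_left_pos)
    also have "q \<le> (real t + 1) / 1"
      unfolding q_def using \<Lambda> by (intro divide_left_mono) auto
    finally show ?thesis using f_Suc(2)[of "T + j"] j by simp
  qed
  \<comment> \<open>The 72 is \<open>3 * 24\<close>: \<open>\<gamma>\<close> equals
    \<open>\<epsilon> * (t + 1) / (24 * \<Lambda>)\<close>, and the 3 passes from
    \<open>t + 1\<close> to \<open>f T' + 1\<close>.\<close>
  have "\<epsilon> * (f T' + 1) / (72 * \<Lambda>) \<le> \<epsilon> * (3 * (real t + 1)) / (72 * \<Lambda>)"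
    using f_end \<epsilon> \<Lambda> by (intro divide_right_mono mult_left_mono) auto
  also have "\<dots> = \<gamma>" unfolding \<gamma>_def q_def using \<Lambda> by (simp add: field_simps)
  finally have "(1 - \<gamma>) * k \<le> (1 - \<epsilon> * (f T' + 1) / (72 * \<Lambda>)) * k" by (intro mult_right_mono) auto
  then show ?thesis using T' unfolding c_def f_def by (intro exI[of _ T']) linarith
qed

text \<open>Even the stopping index can be read off the fingerprint: the run on \<open>F\<close>
  agrees with the run on \<open>I\<close> up to the first good index, hence stops there too. So one
  function \<open>g\<close> serves all independent sets.\<close>

lemma containers_exist:
  fixes \<epsilon> \<Lambda> :: real
  assumes "0 < k" "k < card V" "\<epsilon> > 0" "\<Lambda> \<ge> 1" "ln (card V / k) \<le> \<Lambda>"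
    and "\<And>W. W \<subseteq> V \<Longrightarrow> card W = k \<Longrightarrow> \<epsilon> * (real k)\<^sup>2 \<le> degsum W"
  shows "\<exists>g. \<forall>I\<subseteq>V. (\<forall>u\<in>I. \<forall>v\<in>I. \<not> R u v) \<longrightarrow>
    (\<exists>F\<subseteq>I. g F \<subseteq> V \<and> F \<inter> g F = {} \<and> I \<subseteq> F \<union> g F \<and>
      card (g F) \<le> (1 - \<epsilon> * (card F + 1) / (72 * \<Lambda>)) * k)"
proof -
  define P where "P X \<longleftrightarrow> card (snd X) \<le> (1 - \<epsilon> * (card (fst X) + 1) / (72 * \<Lambda>)) * k"
    for X :: "'a set \<times> 'a set"
  define g where "g F = container F (LEAST i. P (run F i))" for F
  have "\<exists>F\<subseteq>I. g F \<subseteq> V \<and> F \<inter> g F = {} \<and> I \<subseteq> F \<union> g F \<and>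
      card (g F) \<le> (1 - \<epsilon> * (card F + 1) / (72 * \<Lambda>)) * k"
    if I: "I \<subseteq> V" "\<forall>u\<in>I. \<forall>v\<in>I. \<not> R u v" for I
  proof -
    define i where "i = (LEAST i. P (run I i))"
    define F where "F = fingerprint I i"
    have "\<exists>i. P (run I i)"
      unfolding P_def using small_container_exists[OF assms] by (simp add: fingerprint_def container_def)
    then have i: "P (run I i)" unfolding i_def by (rule LeastI_ex)
    have "(LEAST i. P (run F i)) = i"
    proof (rule Least_equality)
      show "P (run F i)" using i by (simp add: F_def run_fingerprint)
      fix j assume "P (run F j)"
      then have "P (run I j)" if "j \<le> i" using that by (simp add: F_def run_fingerprint)
      then show "i \<le> j" unfolding i_def by (metis Least_le nle_le)
    qed
    then have g: "g F = container I i"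
      by (simp add: g_def F_def container_def run_fingerprint)
    show ?thesis
    proof (intro exI[of _ F] conjI)
      show "card (g F) \<le> (1 - \<epsilon> * (card F + 1) / (72 * \<Lambda>)) * k"
        using i g by (simp add: P_def F_def fingerprint_def container_def)
    qed (use g fingerprint_subset container_subset fingerprint_disjoint run_covers[of I i] I in
        \<open>auto simp: F_def\<close>)
  qed
  then show ?thesis by blast
qed

end

section \<open>Tail bounds for uniformly random subsets\<close>

lemma sum_power_card_Pow:
  fixes y :: "'a :: comm_semiring_1"
  assumes "finite A"
  shows "(\<Sum>T\<in>Pow A. y ^ card T) = (1 + y) ^ card A"
  using prod_add[OF assms, of "\<lambda>_. y" "\<lambda>_. 1"] by (simp add: add.commute)

lemma card_nsets_supersets:
  assumes "finite V" "X \<subseteq> V" "card X \<le> s"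
  shows "card {S \<in> [V]\<^bsup>s\<^esup>. X \<subseteq> S} = (card V - card X) choose (s - card X)"
proof -
  have fX: "finite X" using assms finite_subset by blast
  have "bij_betw (\<lambda>T. X \<union> T) ([V - X]\<^bsup>(s - card X)\<^esup>) {S \<in> [V]\<^bsup>s\<^esup>. X \<subseteq> S}"
  proof (rule bij_betw_byWitness[where f' = "\<lambda>S. S - X"])
    show "(\<lambda>T. X \<union> T) ` [V - X]\<^bsup>(s - card X)\<^esup> \<subseteq> {S \<in> [V]\<^bsup>s\<^esup>. X \<subseteq> S}"
      using assms fX by (auto simp: nsets_def) (subst card_Un_disjoint, auto)
    show "(\<lambda>S. S - X) ` {S \<in> [V]\<^bsup>s\<^esup>. X \<subseteq> S} \<subseteq> [V - X]\<^bsup>(s - card X)\<^esup>"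
      using fX by (auto simp: nsets_def card_Diff_subset)
  qed (auto simp: nsets_def)
  then have "card {S \<in> [V]\<^bsup>s\<^esup>. X \<subseteq> S} = card ([V - X]\<^bsup>(s - card X)\<^esup>)"
    using bij_betw_same_card by fastforce
  then show ?thesis using assms fX by (simp add: card_nsets card_Diff_subset)
qed

text \<open>The quotient of the binomials is a product of \<open>i\<close> factors
  \<open>(s - j) / (n - j)\<close>, each at most \<open>s / n\<close>. Thus a fixed
  \<open>i\<close>-set is no likelier to be sampled than under independent choices with rate
  \<open>s / n\<close>.\<close>

lemma binomial_diff_le:
  assumes "i \<le> s" "s \<le> n" "0 < n"
  shows "real ((n - i) choose (s - i)) \<le> (n choose s) * (s / n) ^ i"
  using assms(1)
proof (induction i)
  case (Suc i)
  define m r where "m = n - Suc i" and "r = s - Suc i"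
  have eq: "n - i = Suc m" "s - i = Suc r" using Suc.prems assms by (auto simp: m_def r_def)
  have "Suc r * (Suc m choose Suc r) = Suc m * (m choose r)"
    using binomial_absorption[of r "Suc m"] by simp
  then have "real (Suc r) * (Suc m choose Suc r) = real (Suc m) * (m choose r)"
    by (metis of_nat_mult)
  then have "real (m choose r) = (real (Suc r) / real (Suc m)) * (Suc m choose Suc r)"
    by (simp add: field_simps)
  also have "\<dots> \<le> (s / n) * ((n choose s) * (s / n) ^ i)"
  proof (intro mult_mono)
    have "(s - i) * n \<le> s * (n - i)"
      using mult_le_mono2[OF assms(2), of i]
      by (simp add: diff_mult_distrib diff_mult_distrib2 diff_le_mono2 mult.commute)
    then have "real (Suc r) * n \<le> s * real (Suc m)" unfolding eq by (metis of_nat_le_iff of_nat_mult)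
    then show "real (Suc r) / real (Suc m) \<le> s / n" using assms by (simp add: field_simps)
    show "real (Suc m choose Suc r) \<le> (n choose s) * (s / n) ^ i" using Suc eq by simp
  qed auto
  finally show ?case by (simp add: m_def r_def mult_ac)
qed simp

lemma card_nsets_supersets_le:
  assumes "finite V" "V \<noteq> {}" "X \<subseteq> V" "s \<le> card V"
  shows "card {S \<in> [V]\<^bsup>s\<^esup>. X \<subseteq> S} \<le> (card V choose s) * (s / card V) ^ card X"
proof (cases "card X \<le> s")
  case True
  then show ?thesis
    using binomial_diff_le[OF True assms(4)] card_nsets_supersets[OF assms(1,3) True] assms
    by (simp add: card_gt_0_iff)
next
  case False
  have "{S \<in> [V]\<^bsup>s\<^esup>. X \<subseteq> S} = {}"
    using False by (auto simp: nsets_def dest: card_mono)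
  then show ?thesis by (simp only: card.empty) simp
qed

text \<open>Equality is required here, since the mean enters the variance with a negative
  sign.\<close>

lemma card_nsets_containing:
  assumes "finite V" "v \<in> V" "s \<le> card V"
  shows "real (card {S \<in> [V]\<^bsup>s\<^esup>. v \<in> S}) = (card V choose s) * (s / card V)"
proof (cases s)
  case 0
  then show ?thesis by (auto simp: nsets_def card_eq_0_iff)
next
  case (Suc r)
  have pos: "card V > 0" using assms by (auto simp: card_gt_0_iff)
  have "Suc r * (card V choose Suc r) = card V * (card V - 1 choose r)"
    by (rule binomial_absorption)
  then have "real (Suc r) * (card V choose Suc r) = real (card V) * (card V - 1 choose r)"
    by (metis of_nat_mult)
  then have "real (card V - 1 choose r) = (card V choose Suc r) * (real (Suc r) / card V)"
    using pos by (simp add: field_simps)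
  then show ?thesis using card_nsets_supersets[of V "{v}" s] assms Suc by simp
qed

section \<open>Moments and tails of the intersection with a fixed set\<close>

lemma sum_card_Int_nsets:
  assumes "finite V" "K \<subseteq> V" "s \<le> card V"
  shows "(\<Sum>S\<in>[V]\<^bsup>s\<^esup>. real (card (S \<inter> K))) = (card V choose s) * (s * card K / card V)"
proof -
  have fin: "finite K" "finite ([V]\<^bsup>s\<^esup>)"
    using assms finite_subset finite_imp_finite_nsets by blast+
  have "(\<Sum>S\<in>[V]\<^bsup>s\<^esup>. real (card (S \<inter> K))) = (\<Sum>S\<in>[V]\<^bsup>s\<^esup>. \<Sum>v\<in>K. if v \<in> S then 1 else 0)"
    using fin by (intro sum.cong refl) (simp add: sum.If_cases Int_commute)
  also have "\<dots> = (\<Sum>v\<in>K. \<Sum>S\<in>[V]\<^bsup>s\<^esup>. if v \<in> S then 1 else 0)" by (rule sum.swap)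
  also have "\<dots> = (\<Sum>v\<in>K. real (card {S \<in> [V]\<^bsup>s\<^esup>. v \<in> S}))"
    using fin by (simp add: sum.If_cases Int_def)
  also have "\<dots> = (\<Sum>v\<in>K. (card V choose s) * (s / card V))"
    using assms by (intro sum.cong refl card_nsets_containing) auto
  finally show ?thesis by simp
qed

text \<open>The square counts ordered pairs; the diagonal contributes the mean and every other pair
  at most \<open>(s / card V)\<^sup>2\<close>. So the variance is at most the mean, as for
  independent choices.\<close>

lemma sum_card_Int_nsets_squared_le:
  assumes "finite V" "V \<noteq> {}" "K \<subseteq> V" "s \<le> card V"
  shows "(\<Sum>S\<in>[V]\<^bsup>s\<^esup>. (real (card (S \<inter> K)))\<^sup>2)
    \<le> (card V choose s) * (s * card K / card V + (s * card K / card V)\<^sup>2)"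
proof -
  define N p where "N = real (card V choose s)" and "p = s / card V"
  have p: "p \<ge> 0" "N \<ge> 0" by (auto simp: p_def N_def)
  have fin: "finite K" "finite ([V]\<^bsup>s\<^esup>)"
    using assms finite_subset finite_imp_finite_nsets by blast+
  have "(\<Sum>S\<in>[V]\<^bsup>s\<^esup>. (real (card (S \<inter> K)))\<^sup>2)
      = (\<Sum>S\<in>[V]\<^bsup>s\<^esup>. (\<Sum>u\<in>K. \<Sum>v\<in>K. if u \<in> S \<and> v \<in> S then 1 else 0))"
  proof (intro sum.cong refl)
    fix S assume "S \<in> [V]\<^bsup>s\<^esup>"
    have "real (card (S \<inter> K)) = (\<Sum>v\<in>K. if v \<in> S then 1 else 0)"
      using fin by (simp add: sum.If_cases Int_commute)
    then have "(real (card (S \<inter> K)))\<^sup>2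
        = (\<Sum>u\<in>K. \<Sum>v\<in>K. (if u \<in> S then 1 else 0) * (if v \<in> S then 1 else 0))"
      by (simp only: power2_eq_square sum_product)
    also have "\<dots> = (\<Sum>u\<in>K. \<Sum>v\<in>K. if u \<in> S \<and> v \<in> S then 1 else 0)"
      by (intro sum.cong refl) auto
    finally show "(real (card (S \<inter> K)))\<^sup>2 = \<dots>" .
  qed
  also have "\<dots> = (\<Sum>u\<in>K. \<Sum>v\<in>K. \<Sum>S\<in>[V]\<^bsup>s\<^esup>. if u \<in> S \<and> v \<in> S then 1 else 0)"
    by (subst sum.swap) (intro sum.cong refl sum.swap)
  also have "\<dots> = (\<Sum>u\<in>K. \<Sum>v\<in>K. real (card {S \<in> [V]\<^bsup>s\<^esup>. {u, v} \<subseteq> S}))"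
    using fin by (simp add: sum.If_cases Int_def)
  also have "\<dots> \<le> (\<Sum>u\<in>K. \<Sum>v\<in>K. (if u = v then N * p else 0) + N * p\<^sup>2)"
  proof (intro sum_mono)
    fix u v assume uv: "u \<in> K" "v \<in> K"
    have "real (card {S \<in> [V]\<^bsup>s\<^esup>. {u, v} \<subseteq> S}) \<le> N * p ^ card {u, v}"
      unfolding N_def p_def using assms uv by (intro card_nsets_supersets_le) auto
    also have "\<dots> \<le> (if u = v then N * p else 0) + N * p\<^sup>2"
      using p by (auto simp: card_insert_if power2_eq_square)
    finally show "real (card {S \<in> [V]\<^bsup>s\<^esup>. {u, v} \<subseteq> S}) \<le> \<dots>" .
  qed
  also have "\<dots> = N * (card K * p + (card K * p)\<^sup>2)"
    using fin by (simp add: sum.distrib algebra_simps power2_eq_square)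
  finally show ?thesis by (simp add: N_def p_def mult_ac)
qed

lemma sum_card_Int_nsets_variance_le:
  fixes \<mu> :: real
  assumes "finite V" "V \<noteq> {}" "K \<subseteq> V" "s \<le> card V" and \<mu>: "\<mu> = s * card K / card V"
  shows "(\<Sum>S\<in>[V]\<^bsup>s\<^esup>. (card (S \<inter> K) - \<mu>)\<^sup>2) \<le> (card V choose s) * \<mu>"
proof -
  have "(\<Sum>S\<in>[V]\<^bsup>s\<^esup>. (card (S \<inter> K) - \<mu>)\<^sup>2) =
      (\<Sum>S\<in>[V]\<^bsup>s\<^esup>. (real (card (S \<inter> K)))\<^sup>2) - 2 * \<mu> * (\<Sum>S\<in>[V]\<^bsup>s\<^esup>. real (card (S \<inter> K)))
      + (card V choose s) * \<mu>\<^sup>2"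
    using assms(1)
    by (simp add: power2_diff sum.distrib sum_subtractf card_nsets flip: sum_distrib_left sum_distrib_right)
  also have "\<dots> \<le> (card V choose s) * (\<mu> + \<mu>\<^sup>2) - 2 * \<mu> * ((card V choose s) * \<mu>) + (card V choose s) * \<mu>\<^sup>2"
    using sum_card_Int_nsets_squared_le[OF assms(1-4)] sum_card_Int_nsets[OF assms(1,3,4)] \<mu> by simp
  finally show ?thesis by (simp add: algebra_simps power2_eq_square)
qed

text \<open>Chebyshev's inequality in counting form. A constant failure rate suffices because it is
  applied to a single clique.\<close>

lemma card_nsets_lower_tail:
  fixes \<mu> \<eta> :: real
  assumes "finite V" "V \<noteq> {}" "K \<subseteq> V" "s \<le> card V" and \<mu>: "\<mu> = s * card K / card V" "\<mu> > 0"
    and \<eta>: "\<eta> > 0"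
  shows "card {S \<in> [V]\<^bsup>s\<^esup>. card (S \<inter> K) < (1 - \<eta>) * \<mu>} \<le> (card V choose s) / (\<eta>\<^sup>2 * \<mu>)"
proof -
  let ?E = "{S \<in> [V]\<^bsup>s\<^esup>. card (S \<inter> K) < (1 - \<eta>) * \<mu>}"
  have fin: "finite ([V]\<^bsup>s\<^esup>)" using assms(1) finite_imp_finite_nsets by blast
  have "card ?E * (\<eta> * \<mu>)\<^sup>2 = (\<Sum>S\<in>?E. (\<eta> * \<mu>)\<^sup>2)" by simp
  also have "\<dots> \<le> (\<Sum>S\<in>?E. (card (S \<inter> K) - \<mu>)\<^sup>2)"
  proof (intro sum_mono)
    fix S assume "S \<in> ?E"
    then have "\<eta> * \<mu> \<le> \<mu> - card (S \<inter> K)" by (simp add: algebra_simps)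
    then have "(\<eta> * \<mu>)\<^sup>2 \<le> (\<mu> - card (S \<inter> K))\<^sup>2" using \<eta> \<mu> by (intro power_mono) auto
    then show "(\<eta> * \<mu>)\<^sup>2 \<le> (card (S \<inter> K) - \<mu>)\<^sup>2" by (simp add: power2_commute)
  qed
  also have "\<dots> \<le> (\<Sum>S\<in>[V]\<^bsup>s\<^esup>. (card (S \<inter> K) - \<mu>)\<^sup>2)"
    using fin by (intro sum_mono2) auto
  also have "\<dots> \<le> (card V choose s) * \<mu>"
    by (rule sum_card_Int_nsets_variance_le[OF assms(1-4) \<mu>(1)])
  finally have "(card ?E * (\<eta>\<^sup>2 * \<mu>)) * \<mu> \<le> (card V choose s) * \<mu>"
    by (simp add: power2_eq_square mult_ac)
  then have "card ?E * (\<eta>\<^sup>2 * \<mu>) \<le> (card V choose s)" using \<mu>(2) by simp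
  then show ?thesis using \<eta> \<mu>(2) by (simp add: pos_le_divide_eq)
qed

text \<open>Expanding the power over subsets \<open>T\<close> of \<open>S \<inter> C\<close> leaves
  samples containing \<open>F \<union> T\<close> to be counted. Disjointness makes the exponents
  add, and the sum over \<open>T\<close> folds back into a product as for independent
  choices.\<close>

lemma nsets_exponential_moment:
  fixes z :: real
  assumes "finite V" "V \<noteq> {}" "F \<subseteq> V" "C \<subseteq> V" "F \<inter> C = {}" "s \<le> card V" "z \<ge> 0"
  shows "(\<Sum>S | S \<in> [V]\<^bsup>s\<^esup> \<and> F \<subseteq> S. (1 + z) ^ card (S \<inter> C))
    \<le> (card V choose s) * (s / card V) ^ card F * (1 + z * s / card V) ^ card C"
proof -
  define N p where "N = real (card V choose s)" and "p = s / card V"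
  let ?X = "{S \<in> [V]\<^bsup>s\<^esup>. F \<subseteq> S}"
  have fin: "finite C" "finite F" "finite ?X"
    using assms finite_imp_finite_nsets[of V s] by (auto intro: finite_subset)
  have "(\<Sum>S\<in>?X. (1 + z) ^ card (S \<inter> C)) = (\<Sum>S\<in>?X. \<Sum>T\<in>Pow C. if T \<subseteq> S then z ^ card T else 0)"
  proof (intro sum.cong refl)
    fix S
    have "(1 + z) ^ card (S \<inter> C) = (\<Sum>T\<in>Pow (S \<inter> C). z ^ card T)"
      using fin by (subst sum_power_card_Pow) auto
    also have "\<dots> = (\<Sum>T\<in>Pow C. if T \<subseteq> S then z ^ card T else 0)"
      using fin by (subst sum.inter_filter[symmetric]) (auto intro!: sum.cong)
    finally show "(1 + z) ^ card (S \<inter> C) = \<dots>" .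
  qed
  also have "\<dots> = (\<Sum>T\<in>Pow C. \<Sum>S\<in>?X. if T \<subseteq> S then z ^ card T else 0)" by (rule sum.swap)
  also have "\<dots> = (\<Sum>T\<in>Pow C. card {S \<in> [V]\<^bsup>s\<^esup>. F \<union> T \<subseteq> S} * z ^ card T)"
  proof (intro sum.cong refl)
    fix T
    have "(\<Sum>S\<in>?X. if T \<subseteq> S then z ^ card T else 0) = card {S \<in> ?X. T \<subseteq> S} * z ^ card T"
      using fin by (subst sum.inter_filter[symmetric]) auto
    also have "{S \<in> ?X. T \<subseteq> S} = {S \<in> [V]\<^bsup>s\<^esup>. F \<union> T \<subseteq> S}" by auto
    finally show "(\<Sum>S\<in>?X. if T \<subseteq> S then z ^ card T else 0)
        = card {S \<in> [V]\<^bsup>s\<^esup>. F \<union> T \<subseteq> S} * z ^ card T" .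
  qed
  also have "\<dots> \<le> (\<Sum>T\<in>Pow C. N * p ^ card F * (z * p) ^ card T)"
  proof (intro sum_mono)
    fix T assume T: "T \<in> Pow C"
    then have "card (F \<union> T) = card F + card T"
      using fin assms by (intro card_Un_disjoint) (auto intro: finite_subset)
    moreover have "card {S \<in> [V]\<^bsup>s\<^esup>. F \<union> T \<subseteq> S} \<le> N * p ^ card (F \<union> T)"
      unfolding N_def p_def using assms T by (intro card_nsets_supersets_le) auto
    ultimately have "card {S \<in> [V]\<^bsup>s\<^esup>. F \<union> T \<subseteq> S} * z ^ card T
        \<le> N * p ^ (card F + card T) * z ^ card T"
      using assms by (intro mult_right_mono) auto
    then show "card {S \<in> [V]\<^bsup>s\<^esup>. F \<union> T \<subseteq> S} * z ^ card T \<le> N * p ^ card F * (z * p) ^ card T"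
      by (simp add: power_add power_mult_distrib mult_ac)
  qed
  also have "\<dots> = N * p ^ card F * (1 + z * p) ^ card C"
    using fin by (simp add: sum_power_card_Pow flip: sum_distrib_left)
  finally show ?thesis by (simp add: N_def p_def)
qed

text \<open>Markov's inequality for \<open>(1 + z) ^ card (S \<inter> C)\<close>. Lowering the
  threshold by \<open>card F\<close> costs only a factor \<open>exp (card F)\<close>, since
  \<open>ln (1 + z) \<le> 1\<close>.\<close>

lemma card_nsets_upper_tail:
  fixes \<mu> \<gamma> :: real and k :: nat
  assumes "finite V" "V \<noteq> {}" "F \<subseteq> V" "C \<subseteq> V" "F \<inter> C = {}" "s \<le> card V"
    and \<gamma>: "0 < \<gamma>" "\<gamma> \<le> 1" and \<mu>: "\<mu> = s * k / card V" and C: "card C \<le> (1 - \<gamma>) * k"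
  shows "card {S \<in> [V]\<^bsup>s\<^esup>. F \<subseteq> S \<and> (1 - \<gamma> / 4) * \<mu> - card F \<le> card (S \<inter> C)}
    \<le> (card V choose s) * (s / card V) ^ card F * exp (card F - \<gamma>\<^sup>2 * \<mu> / 8)"
proof -
  \<comment> \<open>Apart from \<open>card F\<close>, the threshold exceeds
    \<open>(1 - \<gamma>) * \<mu>\<close> by \<open>3 / 4 * \<gamma> * \<mu>\<close>. With
    \<open>z = \<gamma> / 2\<close> the gain \<open>3 / 4 * \<gamma> * z\<close> beats the loss
    \<open>z\<^sup>2\<close> from bounding \<open>ln (1 + z)\<close> by
    \<open>\<gamma>\<^sup>2 / 8\<close>.\<close>
  define z l b where "z = \<gamma> / 2" and "l = ln (1 + z)" and "b = (1 - \<gamma> / 4) * \<mu> - card F"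
  define M where "M = (card V choose s) * (s / card V) ^ card F"
  have z: "0 \<le> z" "z \<le> 1" using \<gamma> by (auto simp: z_def)
  have l: "z - z\<^sup>2 \<le> l" "l \<le> z" "0 \<le> l" unfolding l_def
    using z ln_one_plus_pos_lower_bound[of z] ln_add_one_self_le_self[of z] by auto
  have M: "M \<ge> 0" unfolding M_def by simp
  have \<mu>0: "\<mu> \<ge> 0" by (simp add: \<mu>)
  let ?E = "{S \<in> [V]\<^bsup>s\<^esup>. F \<subseteq> S \<and> b \<le> card (S \<inter> C)}"
  let ?X = "{S \<in> [V]\<^bsup>s\<^esup>. F \<subseteq> S}"
  have fin: "finite ?X" using assms(1) finite_imp_finite_nsets[of V s] by auto
  have pw: "(1 + z) ^ m = exp (m * l)" for m :: nat
    unfolding l_def using z by (simp add: exp_of_nat_mult)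
  have "real (card ?E) = (\<Sum>S\<in>?E. 1)" by simp
  also have "\<dots> \<le> (\<Sum>S\<in>?E. exp (- (l * b)) * (1 + z) ^ card (S \<inter> C))"
  proof (intro sum_mono)
    fix S assume "S \<in> ?E"
    then have "l * b \<le> l * card (S \<inter> C)" using l by (intro mult_left_mono) auto
    then show "1 \<le> exp (- (l * b)) * (1 + z) ^ card (S \<inter> C)"
      by (simp add: pw mult.commute flip: exp_add)
  qed
  also have "\<dots> \<le> (\<Sum>S\<in>?X. exp (- (l * b)) * (1 + z) ^ card (S \<inter> C))"
    using fin z by (intro sum_mono2) auto
  also have "\<dots> = exp (- (l * b)) * (\<Sum>S\<in>?X. (1 + z) ^ card (S \<inter> C))"
    by (simp add: sum_distrib_left)
  also have "\<dots> \<le> exp (- (l * b)) * (M * (1 + z * s / card V) ^ card C)"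
    unfolding M_def using nsets_exponential_moment[OF assms(1-6) z(1)] by (intro mult_left_mono) auto
  also have "\<dots> \<le> exp (- (l * b)) * (M * exp (z * \<mu> * (1 - \<gamma>)))"
  proof (intro mult_left_mono M)
    have "(1 + z * s / card V) ^ card C \<le> exp (z * s / card V) ^ card C"
      using z by (intro power_mono exp_ge_add_one_self) auto
    also have "\<dots> = exp (z * s / card V * card C)"
      by (subst mult.commute) (simp only: exp_of_nat_mult)
    also have "\<dots> \<le> exp (z * s / card V * ((1 - \<gamma>) * k))"
      using C z by (subst exp_le_cancel_iff, intro mult_left_mono) auto
    also have "\<dots> = exp (z * \<mu> * (1 - \<gamma>))" by (simp add: \<mu> mult_ac)
    finally show "(1 + z * s / card V) ^ card C \<le> \<dots>" .
  qed auto
  also have "\<dots> = M * exp (z * \<mu> * (1 - \<gamma>) - l * b)"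
    by (simp only: diff_conv_add_uminus exp_add mult_ac)
  also have "\<dots> \<le> M * exp (card F - \<gamma>\<^sup>2 * \<mu> / 8)"
  proof (intro mult_left_mono M, subst exp_le_cancel_iff)
    have "l * b = l * ((1 - \<gamma> / 4) * \<mu>) - l * card F" by (simp add: b_def algebra_simps)
    moreover have "l * card F \<le> 1 * real (card F)" using l z by (intro mult_right_mono) auto
    moreover have "(z - z\<^sup>2) * ((1 - \<gamma> / 4) * \<mu>) \<le> l * ((1 - \<gamma> / 4) * \<mu>)"
      using l \<gamma> \<mu>0 by (intro mult_right_mono) auto
    moreover have "z * \<mu> * (1 - \<gamma>) - (z - z\<^sup>2) * ((1 - \<gamma> / 4) * \<mu>) = - (\<gamma>\<^sup>2 * \<mu> / 8) - \<gamma>^3 * \<mu> / 16"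
      unfolding z_def by (simp add: field_simps power2_eq_square power3_eq_cube)
    moreover have "0 \<le> \<gamma>^3 * \<mu> / 16" using \<gamma> \<mu>0 by simp
    ultimately show "z * \<mu> * (1 - \<gamma>) - l * b \<le> card F - \<gamma>\<^sup>2 * \<mu> / 8" by linarith
  qed
  finally show ?thesis unfolding b_def M_def .
qed

section \<open>Counting accepted samples and the union bound\<close>

lemma acceptance_prob_deterministic:
  assumes "finite V" "s \<le> card V"
  shows "acceptance_prob (\<lambda>S E. return_pmf (P S E)) s V E =
    card {S \<in> [V]\<^bsup>s\<^esup>. P S (induced_edges E S)} / (card V choose s)"
proof -
  have fin: "finite ([V]\<^bsup>s\<^esup>)" "[V]\<^bsup>s\<^esup> \<noteq> {}"
    using assms by (auto simp: finite_imp_finite_nsets nsets_eq_empty_iff)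
  have "acceptance_prob (\<lambda>S E. return_pmf (P S E)) s V E =
    (\<Sum>S\<in>[V]\<^bsup>s\<^esup>. pmf (return_pmf (P S (induced_edges E S))) True) / card ([V]\<^bsup>s\<^esup>)"
    unfolding acceptance_prob_def using fin by (intro pmf_bind_pmf_of_set)
  also have "(\<Sum>S\<in>[V]\<^bsup>s\<^esup>. pmf (return_pmf (P S (induced_edges E S))) True)
      = (\<Sum>S\<in>[V]\<^bsup>s\<^esup>. if P S (induced_edges E S) then 1 else (0 :: real))"
    by (intro sum.cong refl) auto
  also have "\<dots> = card {S \<in> [V]\<^bsup>s\<^esup>. P S (induced_edges E S)}"
    using fin by (simp add: sum.If_cases Int_def)
  finally show ?thesis using assms by (simp add: card_nsets)
qed

text \<open>\<open>ln s\<close> is of order \<open>\<Lambda>\<close>, while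
  \<open>\<gamma>\<^sup>2 * \<mu> / 8\<close> is at least \<open>50 * (j + 1) * \<Lambda>\<close>:
  in the product, \<open>\<delta>\<^sup>2\<close> and two of the three powers of
  \<open>\<Lambda>\<close> cancel. So the exponent pays for \<open>j * ln s\<close> for every
  \<open>j\<close> at once.\<close>

lemma fingerprint_cost_le:
  fixes x \<Lambda> \<delta> \<gamma> \<mu> :: real and s j :: nat
  assumes x: "x \<ge> 1" and \<Lambda>: "\<Lambda> = 1 + ln x" and \<delta>: "\<delta> > 0"
    and s: "0 < s" "s \<le> 2 ^ 24 * (x * \<Lambda> ^ 3)"
    and \<mu>: "2 ^ 23 * \<Lambda> ^ 3 / \<delta>\<^sup>2 \<le> \<mu>" and \<gamma>: "\<gamma> = \<delta> * (j + 1) / (144 * \<Lambda>)"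
  shows "s ^ j * exp (j - \<gamma>\<^sup>2 * \<mu> / 8) \<le> exp (- (j + 3))"
proof -
  have \<Lambda>1: "\<Lambda> \<ge> 1" using x \<Lambda> by simp
  have "ln s \<le> ln (2 ^ 24 * (x * \<Lambda> ^ 3))" using s by (subst ln_le_cancel_iff) auto
  also have "\<dots> = 24 * ln 2 + ln x + 3 * ln \<Lambda>"
    using x \<Lambda>1 ln_realpow[of 2 24] by (simp add: ln_mult_pos ln_realpow)
  also have "\<dots> \<le> 24 * 1 + ln x + 3 * (\<Lambda> - 1)"
    using \<Lambda>1 ln_le_minus_one[of \<Lambda>] ln_le_minus_one[of 2] by (intro add_mono mult_left_mono) auto
  finally have ln_s: "ln s \<le> 4 * \<Lambda> + 20" using \<Lambda> by simp
  \<comment> \<open>165888 is \<open>8 * 144\<^sup>2\<close>, and \<open>2 ^ 23 / 165888\<close> is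
    just above 50.\<close>
  have "50 * (real j + 1) * \<Lambda> \<le> 2 ^ 23 / 165888 * ((real j + 1) * \<Lambda>)" using \<Lambda>1 by simp
  also have "\<dots> \<le> 2 ^ 23 / 165888 * ((real j + 1)\<^sup>2 * \<Lambda>)"
    using \<Lambda>1 by (intro mult_left_mono mult_right_mono) (auto simp: power2_eq_square)
  also have "\<dots> = \<gamma>\<^sup>2 * (2 ^ 23 * \<Lambda> ^ 3 / \<delta>\<^sup>2) / 8"
    unfolding \<gamma> using \<delta> \<Lambda>1 by (simp add: field_simps power2_eq_square power3_eq_cube)
  also have "\<dots> \<le> \<gamma>\<^sup>2 * \<mu> / 8" using \<mu> by (intro divide_right_mono mult_left_mono) auto
  finally have big: "50 * (real j + 1) * \<Lambda> \<le> \<gamma>\<^sup>2 * \<mu> / 8" .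
  have "real j * ln s \<le> j * (4 * \<Lambda> + 20)" using ln_s by (intro mult_left_mono) auto
  moreover have "j * (4 * \<Lambda> + 20) + 2 * j + 3 \<le> (real j + 1) * (4 * \<Lambda> + 22)"
    using \<Lambda>1 by (simp add: algebra_simps)
  moreover have "(real j + 1) * (4 * \<Lambda> + 22) \<le> (real j + 1) * (50 * \<Lambda>)"
    using \<Lambda>1 by (intro mult_left_mono) auto
  ultimately have "real j * ln s + (j - \<gamma>\<^sup>2 * \<mu> / 8) \<le> - (j + 3)"
    using big by (simp only: mult_ac of_nat_add)
  moreover have "real (s ^ j) * exp (j - \<gamma>\<^sup>2 * \<mu> / 8) = exp (real j * ln s + (j - \<gamma>\<^sup>2 * \<mu> / 8))"
    unfolding exp_add using s by (simp add: exp_of_nat_mult)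
  ultimately show ?thesis by simp
qed

text \<open>The union bound over all fingerprints \<open>F\<close> contained in the sample.\<close>

lemma card_nsets_large_member_le:
  fixes x \<Lambda> \<delta> :: real and s k :: nat 
    and g :: "'a set \<Rightarrow> 'a set" and P :: "'a set \<Rightarrow> bool"
  assumes V: "finite V" and k: "0 < k" "k < card V" and s: "s \<le> card V"
    and \<delta>: "0 < \<delta>" and x: "x = card V / (\<delta>\<^sup>2 * k)" "x \<ge> 1" and \<Lambda>: "\<Lambda> = 1 + ln x"
    and s_bounds: "2 ^ 23 * (x * \<Lambda> ^ 3) \<le> s" "s \<le> 2 ^ 24 * (x * \<Lambda> ^ 3)"
    and g: "\<And>I. I \<subseteq> V \<Longrightarrow> P I \<Longrightarrow>
      \<exists>F\<subseteq>I. g F \<subseteq> V \<and> F \<inter> g F = {} \<and> I \<subseteq> F \<union> g F \<and>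
        card (g F) \<le> (1 - \<delta> * (card F + 1) / (144 * \<Lambda>)) * k"
  shows "card {S \<in> [V]\<^bsup>s\<^esup>. \<exists>I\<subseteq>S. (1 - \<delta> / (576 * \<Lambda>)) * (s * k / card V) \<le> card I \<and> P I}
    \<le> 3 / 8 * (card V choose s)"
proof -
  define n N \<mu> \<gamma> where "n = card V" and "N = real (card V choose s)" and "\<mu> = s * k / card V"
    and "\<gamma> j = \<delta> * (real j + 1) / (144 * \<Lambda>)" for j :: nat
  have \<Lambda>1: "\<Lambda> \<ge> 1" using x \<Lambda> by simp
  have n: "n > 0" "V \<noteq> {}" using k by (auto simp: n_def)
  have xk: "real k / n = 1 / (x * \<delta>\<^sup>2)" using k \<delta> by (simp add: x n_def)
  have "0 < 2 ^ 23 * (x * \<Lambda> ^ 3)" using x(2) \<Lambda>1 by simp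
  then have s0: "s > 0" using s_bounds by linarith
  have "2 ^ 23 * \<Lambda> ^ 3 / \<delta>\<^sup>2 = 2 ^ 23 * (x * \<Lambda> ^ 3) * (1 / (x * \<delta>\<^sup>2))" using x(2) by simp
  also have "\<dots> \<le> s * (1 / (x * \<delta>\<^sup>2))" using s_bounds x(2) by (intro mult_right_mono) auto
  also have "\<dots> = \<mu>" unfolding xk[symmetric] by (simp add: \<mu>_def n_def)
  finally have \<mu>: "2 ^ 23 * \<Lambda> ^ 3 / \<delta>\<^sup>2 \<le> \<mu>" .
  have \<mu>0: "\<mu> \<ge> 0" by (simp add: \<mu>_def)
  have \<gamma>0: "\<gamma> j > 0" for j using \<delta> \<Lambda>1 by (simp add: \<gamma>_def)
  define Good where "Good = {F \<in> Pow V. g F \<subseteq> V \<and> F \<inter> g F = {} \<and> card (g F) \<le> (1 - \<gamma> (card F)) * k}"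
  define Ev where "Ev F = {S \<in> [V]\<^bsup>s\<^esup>. F \<subseteq> S \<and> (1 - \<gamma> (card F) / 4) * \<mu> - card F \<le> card (S \<inter> g F)}"
    for F
  have finG: "finite Good" using V by (simp add: Good_def)
  have finE: "finite (Ev F)" for F
    using finite_imp_finite_nsets[OF V, of s] by (simp add: Ev_def)
  have sub: "{S \<in> [V]\<^bsup>s\<^esup>. \<exists>I\<subseteq>S. (1 - \<delta> / (576 * \<Lambda>)) * \<mu> \<le> card I \<and> P I} \<subseteq> (\<Union>F\<in>Good. Ev F)"
  proof safe
    fix S I assume S: "S \<in> [V]\<^bsup>s\<^esup>" and I: "I \<subseteq> S" "(1 - \<delta> / (576 * \<Lambda>)) * \<mu> \<le> card I" "P I"
    have SV: "S \<subseteq> V" "finite S" using S by (auto simp: nsets_def)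
    have finI: "finite I" using I SV finite_subset by blast
    obtain F where F: "F \<subseteq> I" "g F \<subseteq> V" "F \<inter> g F = {}" "I \<subseteq> F \<union> g F"
      "card (g F) \<le> (1 - \<delta> * (card F + 1) / (144 * \<Lambda>)) * k"
      using g[of I] I SV by blast
    have good: "F \<in> Good" using F I SV by (auto simp: Good_def \<gamma>_def add.commute)
    have "card I \<le> card (F \<union> (S \<inter> g F))"
      using F I SV finI finite_subset[OF F(1)] by (intro card_mono) auto
    also have "\<dots> \<le> card F + card (S \<inter> g F)" by (rule card_Un_le)
    finally have c: "real (card I) \<le> card F + card (S \<inter> g F)" by linarith
    \<comment> \<open>The left side is \<open>\<gamma> 0 / 4\<close>: the single threshold of the
      test must serve the smallest \<open>\<gamma>\<close>, that of an empty fingerprint.\<close>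
    have "\<delta> / (576 * \<Lambda>) \<le> \<gamma> (card F) / 4"
      unfolding \<gamma>_def using \<delta> \<Lambda>1 by (simp add: field_simps)
    then have "(1 - \<gamma> (card F) / 4) * \<mu> \<le> (1 - \<delta> / (576 * \<Lambda>)) * \<mu>"
      using \<mu>0 by (intro mult_right_mono) auto
    then have "S \<in> Ev F" using S F I c by (auto simp: Ev_def)
    then show "S \<in> (\<Union>F\<in>Good. Ev F)" using good by blast
  qed
  have Ev: "card (Ev F) \<le> N * exp (- 3) * (1 / n) ^ card F" if F: "F \<in> Good" for F
  proof -
    define j where "j = card F"
    have "0 \<le> (1 - \<gamma> j) * k" using F unfolding Good_def j_def by (force intro: order_trans[rotated])
    then have \<gamma>1: "\<gamma> j \<le> 1" using k by (simp add: zero_le_mult_iff)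
    have "card (Ev F) \<le> N * (s / n) ^ j * exp (j - (\<gamma> j)\<^sup>2 * \<mu> / 8)"
      unfolding Ev_def N_def n_def j_def
      by (rule card_nsets_upper_tail[where k = k])
        (use V n F s \<gamma>0 \<gamma>1 in \<open>auto simp: Good_def \<mu>_def j_def\<close>)
    \<comment> \<open>The factor \<open>s ^ j\<close> is absorbed by the tail bound, and
      \<open>(1 / n) ^ j\<close> sums over all subsets of \<open>V\<close> to
      \<open>(1 + 1 / n) ^ n\<close>, at most \<open>exp 1\<close>.\<close>
    also have "\<dots> = N * (1 / n) ^ j * (s ^ j * exp (j - (\<gamma> j)\<^sup>2 * \<mu> / 8))"
      by (simp add: power_divide)
    also have "\<dots> \<le> N * (1 / n) ^ j * exp (- 3)"
    proof (intro mult_left_mono)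
      have "s ^ j * exp (j - (\<gamma> j)\<^sup>2 * \<mu> / 8) \<le> exp (- (j + 3))"
        by (rule fingerprint_cost_le[OF x(2) \<Lambda> \<delta> s0 s_bounds(2) \<mu>]) (simp add: \<gamma>_def add.commute)
      also have "\<dots> \<le> exp (- 3)" by simp
      finally show "s ^ j * exp (j - (\<gamma> j)\<^sup>2 * \<mu> / 8) \<le> exp (- 3)" .
    qed (simp add: N_def)
    finally show ?thesis by (simp add: j_def mult_ac)
  qed
  \<comment> \<open>Source of the acceptance bound \<open>3 / 8\<close>: the union bound totals
    \<open>exp (- 2)\<close>, which is at most a quarter.\<close>
  have e2: "exp 1 * exp (- 3) \<le> (3 / 8 :: real)"
  proof -
    have "(2::real) ^ 2 \<le> exp 1 ^ 2" using exp_ge_add_one_self[of 1] by (intro power_mono) auto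
    then have "4 \<le> exp (2 :: real)" by (simp flip: exp_of_nat_mult)
    then have "inverse (exp (2 :: real)) \<le> inverse 4" by (intro le_imp_inverse_le) auto
    moreover have "exp 1 * exp (- 3) = inverse (exp (2 :: real))"
      by (simp flip: exp_add exp_minus)
    ultimately show ?thesis by simp
  qed
  have "real (card {S \<in> [V]\<^bsup>s\<^esup>. \<exists>I\<subseteq>S. (1 - \<delta> / (576 * \<Lambda>)) * \<mu> \<le> card I \<and> P I})
      \<le> card (\<Union>F\<in>Good. Ev F)"
    using sub finG finE by (intro of_nat_mono card_mono) auto
  also have "\<dots> \<le> (\<Sum>F\<in>Good. real (card (Ev F)))"
    using card_UN_le[OF finG, of Ev] by (simp flip: of_nat_sum)
  also have "\<dots> \<le> (\<Sum>F\<in>Good. N * exp (- 3) * (1 / n) ^ card F)" by (intro sum_mono Ev)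
  also have "\<dots> \<le> (\<Sum>F\<in>Pow V. N * exp (- 3) * (1 / n) ^ card F)"
    using V by (intro sum_mono2) (auto simp: Good_def N_def)
  also have "\<dots> = N * exp (- 3) * (1 + 1 / n) ^ n"
    using V by (simp add: sum_power_card_Pow n_def flip: sum_distrib_left)
  also have "\<dots> \<le> N * exp (- 3) * exp 1"
  proof (intro mult_left_mono)
    have "(1 + 1 / real n) ^ n \<le> exp (1 / n) ^ n" by (intro power_mono exp_ge_add_one_self) auto
    also have "\<dots> = exp 1" using n by (simp flip: exp_of_nat_mult)
    finally show "(1 + 1 / real n) ^ n \<le> exp 1" .
  qed (simp add: N_def)
  also have "\<dots> \<le> N * (3 / 8)"
    using e2 by (simp only: mult.assoc mult.commute[of "exp (- 3)"]) (intro mult_left_mono, auto simp: N_def)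
  finally show ?thesis by (simp add: \<mu>_def N_def)
qed

section \<open>The clique test\<close>

lemma sum_card_incident_edges:
  assumes "finite W" "F \<subseteq> [W]\<^bsup>2\<^esup>"
  shows "(\<Sum>v\<in>W. card {e \<in> F. v \<in> e}) = 2 * card F"
proof -
  have finF: "finite F" using assms finite_imp_finite_nsets finite_subset by blast
  have "(\<Sum>v\<in>W. card {e \<in> F. v \<in> e}) = (\<Sum>v\<in>W. \<Sum>e\<in>F. if v \<in> e then 1 else 0)"
    using finF by (simp add: sum.If_cases Int_def)
  also have "\<dots> = (\<Sum>e\<in>F. \<Sum>v\<in>W. if v \<in> e then 1 else 0)" by (rule sum.swap)
  also have "\<dots> = (\<Sum>e\<in>F. 2)"
  proof (intro sum.cong refl)
    fix e assume "e \<in> F"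
    then have "e \<subseteq> W" "card e = 2" using assms by (auto simp: nsets_def)
    then show "(\<Sum>v\<in>W. if v \<in> e then 1 else 0) = (2 :: nat)"
      using assms by (simp add: sum.If_cases Int_absorb1)
  qed
  finally show ?thesis by simp
qed

text \<open>Sparsity is applied to the induced subgraph on \<open>W\<close>; the remaining pairs of
  distinct vertices are non-adjacent. This supplies the density hypothesis of the container lemma
  for the complement.\<close>

lemma sparse_subgraphs_nonadjacent:
  assumes G: "simple_graph V E" and sp: "sparse_subgraphs V E k \<delta>" and W: "W \<subseteq> V" "card W = k"
  shows "\<delta> * (real k * (real k - 1)) \<le> real (\<Sum>v\<in>W. card {u \<in> W. v \<noteq> u \<and> {v, u} \<notin> E})"
proof -
  have fW: "finite W" using G W finite_subset by (auto simp: simple_graph_def)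
  define F where "F = induced_edges E W"
  have F: "F \<subseteq> [W]\<^bsup>2\<^esup>" "F \<subseteq> E"
    using G unfolding F_def induced_edges_def simple_graph_def nsets_def by auto
  have finF: "finite F" using F fW finite_imp_finite_nsets finite_subset by blast
  have "is_subgraph W F V E" using F fW W by (simp add: is_subgraph_def simple_graph_def)
  then have "real (card F) \<le> (1 - \<delta>) * real (k choose 2)" using sp W by (simp add: sparse_subgraphs_def)
  then have "2 * real (card F) \<le> (1 - \<delta>) * (2 * real (k choose 2))" by simp
  also have "2 * real (k choose 2) = real k * (real k - 1)"
  proof -
    have "2 * (k choose 2) = k * (k - 1)"
      using binomial_absorption[of 1 k] by (simp add: numeral_2_eq_2)
    then have "2 * real (k choose 2) = real (k * (k - 1))" by (metis of_nat_mult of_nat_numeral)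
    then show ?thesis by (cases k) (auto simp: algebra_simps)
  qed
  finally have cF: "2 * real (card F) \<le> (1 - \<delta>) * (real k * (real k - 1))" .
  have "real k - 1 \<le> real (card {u \<in> W. v \<noteq> u \<and> {v, u} \<notin> E}) + card {e \<in> F. v \<in> e}" if v: "v \<in> W" for v
  proof -
    have "card {u \<in> W. v \<noteq> u \<and> {v, u} \<in> E} \<le> card {e \<in> F. v \<in> e}"
      using finite_subset[OF _ finF, of "{e \<in> F. v \<in> e}"] v
      by (intro card_inj_on_le[of "\<lambda>u. {v, u}"])
        (auto simp: inj_on_def doubleton_eq_iff F_def induced_edges_def)
    moreover have "card (W - {v})
        = card ({u \<in> W. v \<noteq> u \<and> {v, u} \<notin> E} \<union> {u \<in> W. v \<noteq> u \<and> {v, u} \<in> E})"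
      by (intro arg_cong[of _ _ card]) auto
    moreover have "\<dots> \<le> card {u \<in> W. v \<noteq> u \<and> {v, u} \<notin> E} + card {u \<in> W. v \<noteq> u \<and> {v, u} \<in> E}"
      by (rule card_Un_le)
    moreover have "card W = Suc (card (W - {v}))" using v fW by (metis card.remove)
    ultimately show ?thesis using W by linarith
  qed
  then have "(\<Sum>v\<in>W. real k - 1)
      \<le> (\<Sum>v\<in>W. real (card {u \<in> W. v \<noteq> u \<and> {v, u} \<notin> E}) + card {e \<in> F. v \<in> e})"
    by (intro sum_mono)
  also have "\<dots> = real (\<Sum>v\<in>W. card {u \<in> W. v \<noteq> u \<and> {v, u} \<notin> E}) + real (2 * card F)"
    using sum_card_incident_edges[OF fW F(1)] by (simp only: sum.distrib flip: of_nat_sum)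
  finally show ?thesis using cF W by (simp add: algebra_simps)
qed

lemma sparse_subgraphs_no_clique:
  assumes "simple_graph V E" "sparse_subgraphs V E k \<delta>" "2 \<le> k" "\<delta> > 0"
  shows "\<not> has_clique V E k"
proof
  assume "has_clique V E k"
  then obtain K where K: "K \<subseteq> V" "finite K" "card K = k" "clique K E"
    by (auto simp: has_clique_def nsets_def)
  have "[K]\<^bsup>2\<^esup> \<subseteq> E" using K(4) by (auto simp: clique_def nsets_2_eq)
  then have "is_subgraph K ([K]\<^bsup>2\<^esup>) V E" using K by (simp add: is_subgraph_def simple_graph_def)
  then have "real (card ([K]\<^bsup>2\<^esup>)) \<le> (1 - \<delta>) * real (k choose 2)"
    using assms(2) K(3) unfolding sparse_subgraphs_def by blast
  then have "\<delta> * real (k choose 2) \<le> 0" using K by (simp add: card_nsets algebra_simps)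
  moreover have "k choose 2 > 0" using assms(3) by (simp add: zero_less_binomial)
  ultimately show False using assms(4) by (simp add: mult_le_0_iff)
qed

text \<open>Subgraphs need not be induced, so an edgeless one on \<open>k\<close> vertices already
  rules out \<open>\<delta> > 1\<close>: type (ii) is then empty.\<close>

lemma sparse_subgraphs_imp_le_1:
  assumes "simple_graph V E" "sparse_subgraphs V E k \<delta>" "2 \<le> k" "k \<le> card V"
  shows "\<delta> \<le> 1"
proof -
  obtain W where W: "W \<subseteq> V" "card W = k" "finite W"
    using obtain_subset_with_card_n[OF assms(4)] by metis
  have "is_subgraph W {} V E" using W by (simp add: is_subgraph_def simple_graph_def)
  then have "real (card ({} :: 'a set set)) \<le> (1 - \<delta>) * real (k choose 2)"
    using assms(2) W unfolding sparse_subgraphs_def by blast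
  moreover have "k choose 2 > 0" using assms(3) by (simp add: zero_less_binomial)
  ultimately show ?thesis by (simp add: zero_le_mult_iff)
qed

definition large_clique_test :: "real \<Rightarrow> 'a set \<Rightarrow> 'a set set \<Rightarrow> bool" where
  "large_clique_test a S E \<longleftrightarrow> (\<exists>I\<subseteq>S. a \<le> card I \<and> clique I E)"

lemma clique_induced_edges_iff: "I \<subseteq> S \<Longrightarrow> clique I (induced_edges E S) \<longleftrightarrow> clique I E"
  by (auto simp: clique_def induced_edges_def)

lemma large_clique_test_induced:
  "large_clique_test a S (induced_edges E S) \<longleftrightarrow> (\<exists>I\<subseteq>S. a \<le> card I \<and> clique I E)"
  by (auto simp: large_clique_test_def clique_induced_edges_iff)

text \<open>The sampled part of the \<open>k\<close>-clique is a clique, and by Chebyshev it falls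
  short with probability at most \<open>1 / (\<eta>\<^sup>2 * \<mu>)\<close>.\<close>

lemma acceptance_prob_clique_ge:
  fixes \<eta> \<mu> :: real
  assumes "simple_graph V E" "has_clique V E k" "s \<le> card V" "V \<noteq> {}"
    and \<mu>: "\<mu> = s * k / card V" "\<mu> > 0" and \<eta>: "\<eta> > 0" "2 \<le> \<eta>\<^sup>2 * \<mu>"
  shows "acceptance_prob (\<lambda>S E. return_pmf (large_clique_test ((1 - \<eta>) * \<mu>) S E)) s V E \<ge> 1 / 2"
proof -
  define N where "N = card V choose s"
  have V: "finite V" using assms by (simp add: simple_graph_def)
  obtain K where K: "K \<subseteq> V" "finite K" "card K = k" "clique K E"
    using assms(2) by (auto simp: has_clique_def nsets_def)
  let ?X = "{S \<in> [V]\<^bsup>s\<^esup>. card (S \<inter> K) < (1 - \<eta>) * \<mu>}"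
  let ?Y = "{S \<in> [V]\<^bsup>s\<^esup>. large_clique_test ((1 - \<eta>) * \<mu>) S (induced_edges E S)}"
  have N: "N > 0" using assms by (simp add: N_def zero_less_binomial)
  have fin: "finite ([V]\<^bsup>s\<^esup>)" using V by (rule finite_imp_finite_nsets)
  have "[V]\<^bsup>s\<^esup> \<subseteq> ?X \<union> ?Y"
  proof
    fix S assume S: "S \<in> [V]\<^bsup>s\<^esup>"
    have "clique (S \<inter> K) E" using K(4) by (auto simp: clique_def)
    then show "S \<in> ?X \<union> ?Y"
      using S unfolding large_clique_test_induced by (cases "card (S \<inter> K) < (1 - \<eta>) * \<mu>") force+
  qed
  then have "card ([V]\<^bsup>s\<^esup>) \<le> card (?X \<union> ?Y)" using fin by (intro card_mono) auto
  then have "N \<le> card ?X + card ?Y"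
    using card_Un_le[of ?X ?Y] by (simp add: N_def card_nsets)
  moreover have "real (card ?X) \<le> N / (\<eta>\<^sup>2 * \<mu>)"
    unfolding N_def using V assms K \<mu> \<eta> by (intro card_nsets_lower_tail) auto
  moreover have "N / (\<eta>\<^sup>2 * \<mu>) \<le> N / 2" using \<eta> by (intro divide_left_mono) auto
  ultimately have "N / 2 \<le> card ?Y" by linarith
  then show ?thesis
    using N unfolding acceptance_prob_deterministic[OF V assms(3)] N_def[symmetric]
    by (simp add: field_simps)
qed

lemma acceptance_prob_sparse_le:
  fixes x \<Lambda> \<delta> :: real and s k :: nat
  assumes G: "simple_graph V E" and sp: "sparse_subgraphs V E k \<delta>"
    and k: "2 \<le> k" "k < card V" and s: "s \<le> card V"
    and \<delta>: "0 < \<delta>" "\<delta> \<le> 1" and x: "x = card V / (\<delta>\<^sup>2 * k)" and \<Lambda>: "\<Lambda> = 1 + ln x"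
    and s_bounds: "2 ^ 23 * (x * \<Lambda> ^ 3) \<le> s" "s \<le> 2 ^ 24 * (x * \<Lambda> ^ 3)"
  shows "acceptance_prob (\<lambda>S E. return_pmf
      (large_clique_test ((1 - \<delta> / (576 * \<Lambda>)) * (s * k / card V)) S E)) s V E \<le> 3 / 8"
proof -
  have V: "finite V" using G by (simp add: simple_graph_def)
  define R where "R u v \<longleftrightarrow> u \<noteq> v \<and> {u, v} \<notin> E" for u v
  interpret loopless_graph V R
    by unfold_locales (auto simp: R_def V insert_commute)
  have "\<delta>\<^sup>2 \<le> 1" using \<delta> by (simp add: power_le_one)
  \<comment> \<open>Through \<open>\<delta> \<le> 1\<close> the single parameter \<open>x\<close>
    also controls \<open>card V / k\<close>, as the containers require.\<close>
  then have nk: "card V / k \<le> x" unfolding x using k \<delta> by (intro divide_left_mono) (auto simp: field_simps)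
  have "1 \<le> card V / k" using k by simp
  then have x1: "x \<ge> 1" using nk by linarith
  have ln: "ln (card V / k) \<le> \<Lambda>" using \<Lambda> ln_mono[OF nk] k by simp
  have \<Lambda>1: "\<Lambda> \<ge> 1" using x1 \<Lambda> by simp
  \<comment> \<open>The half comes from \<open>k - 1 \<ge> k / 2\<close>, valid for
    \<open>2 \<le> k\<close>.\<close>
  have dense: "\<delta> / 2 * (real k)\<^sup>2 \<le> degsum W" if "W \<subseteq> V" "card W = k" for W
  proof -
    have "\<delta> * (real k * (real k / 2)) \<le> \<delta> * (real k * (real k - 1))"
      using k \<delta> by (intro mult_left_mono) auto
    also have "\<dots> \<le> degsum W"
      using sparse_subgraphs_nonadjacent[OF G sp that] by (simp add: degsum_def deg_def R_def)
    finally show ?thesis by (simp add: power2_eq_square mult_ac)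
  qed
  have pos: "0 < k" "0 < \<delta> / 2" using k \<delta> by auto
  obtain g where g: "\<forall>I\<subseteq>V. (\<forall>u\<in>I. \<forall>v\<in>I. \<not> R u v) \<longrightarrow>
      (\<exists>F\<subseteq>I. g F \<subseteq> V \<and> F \<inter> g F = {} \<and> I \<subseteq> F \<union> g F \<and>
        card (g F) \<le> (1 - \<delta> / 2 * (card F + 1) / (72 * \<Lambda>)) * k)"
    by (rule exE[OF containers_exist[OF pos(1) k(2) pos(2) \<Lambda>1 ln dense]])
  have g': "\<exists>F\<subseteq>I. g F \<subseteq> V \<and> F \<inter> g F = {} \<and> I \<subseteq> F \<union> g F \<and>
        card (g F) \<le> (1 - \<delta> * (card F + 1) / (144 * \<Lambda>)) * k" if "I \<subseteq> V" "clique I E" for I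
  proof -
    have "\<forall>u\<in>I. \<forall>v\<in>I. \<not> R u v" using that(2) by (auto simp: R_def clique_def)
    then show ?thesis using g that(1) by simp
  qed
  have "card {S \<in> [V]\<^bsup>s\<^esup>. \<exists>I\<subseteq>S. (1 - \<delta> / (576 * \<Lambda>)) * (s * k / card V) \<le> card I \<and> clique I E}
    \<le> 3 / 8 * (card V choose s)"
    using k by (intro card_nsets_large_member_le[OF V _ k(2) s \<delta>(1) x x1 \<Lambda> s_bounds g']) auto
  moreover have "card V choose s > 0" using s by (simp add: zero_less_binomial)
  ultimately show ?thesis
    unfolding acceptance_prob_deterministic[OF V s] large_clique_test_induced
    by (simp add: pos_divide_le_eq)
qed

section \<open>Assembling the algorithm\<close>

lemma acceptance_prob_whole_graph:
  assumes "simple_graph V E"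
  shows "acceptance_prob (\<lambda>S E. return_pmf (has_clique S E k)) (card V) V E = of_bool (has_clique V E k)"
proof -
  have V: "finite V" using assms by (simp add: simple_graph_def)
  have "S = V" if "S \<in> [V]\<^bsup>card V\<^esup>" for S
    using that V card_subset_eq[of V S] by (simp add: nsets_def)
  then have "[V]\<^bsup>card V\<^esup> = {V}" using V by (auto simp: nsets_def)
  moreover have "induced_edges E V = E"
    using assms by (auto simp: induced_edges_def simple_graph_def nsets_def)
  ultimately have "{S \<in> [V]\<^bsup>card V\<^esup>. has_clique S (induced_edges E S) k} = (if has_clique V E k then {V} else {})"
    by auto
  then show ?thesis using V by (simp add: acceptance_prob_deterministic)
qed

text \<open>For \<open>ln x \<le> 1\<close> the left side is at most \<open>3 * 2 ^ 3\<close>, as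
  \<open>exp 1 \<le> 3\<close>; beyond that \<open>1 + ln x \<le> 2 * ln x\<close>, which costs a
  factor 8.\<close>

lemma shifted_ln_cube_le:
  fixes x :: real
  assumes "x \<ge> 1"
  shows "x * (1 + ln x) ^ 3 \<le> 24 * max 1 (x * ln x ^ 3)"
proof (cases "ln x \<le> 1")
  case True
  then have "x \<le> exp 1" using assms by (metis exp_le_cancel_iff exp_ln less_le_trans zero_less_one)
  then have "x \<le> 3" using exp_le by linarith
  moreover have "(1 + ln x) ^ 3 \<le> 2 ^ 3" using True assms by (intro power_mono) auto
  ultimately have "x * (1 + ln x) ^ 3 \<le> 3 * 2 ^ 3" using assms by (intro mult_mono) auto
  also have "\<dots> \<le> 24 * max 1 (x * ln x ^ 3)" by simp
  finally show ?thesis .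
next
  case False
  then have "(1 + ln x) ^ 3 \<le> (2 * ln x) ^ 3" using assms by (intro power_mono) auto
  then have "x * (1 + ln x) ^ 3 \<le> x * (2 * ln x) ^ 3" using assms by (intro mult_left_mono) auto
  also have "\<dots> = 8 * (x * ln x ^ 3)" by (simp add: power_mult_distrib)
  also have "\<dots> \<le> 24 * max 1 (x * ln x ^ 3)" using False assms by (intro mult_mono) auto
  finally show ?thesis .
qed

text \<open>Three cases: for \<open>\<delta> > 1\<close> no graph is of type (ii), and constant
  acceptance on the empty sample works; if the desired sample exceeds \<open>n\<close>, the whole
  graph is searched exactly; otherwise the clique test applies.\<close>

lemma distinguishing_algorithm_exists:
  fixes n k :: nat and \<delta> :: real
  assumes k: "2 \<le> k" "k < n" and \<delta>: "\<delta> > 0"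
  shows "\<exists>(s::nat) (A :: 'a sample_algorithm).
    s \<le> n \<and> real s \<le> 24 * 2 ^ 24 * sample_bound n k \<delta> \<and>
    (\<forall>V E. simple_graph V E \<and> card V = n \<longrightarrow>
       (has_clique V E k \<longrightarrow> acceptance_prob A s V E \<ge> 1 / 2) \<and>
       (sparse_subgraphs V E k \<delta> \<longrightarrow> acceptance_prob A s V E \<le> 3 / 8))"
proof (cases "\<delta> \<le> 1")
  case False
  have "acceptance_prob (\<lambda>S E. return_pmf True) 0 V E = 1" if "simple_graph V E" for V and E :: "'a set set"
  proof -
    have "[V]\<^bsup>0\<^esup> = {{}}" by (auto simp: nsets_def)
    then show ?thesis using that by (simp add: simple_graph_def acceptance_prob_deterministic)
  qed
  moreover have "\<not> sparse_subgraphs V E k \<delta>" if "simple_graph V E" "card V = n" for V and E :: "'a set set"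
    using sparse_subgraphs_imp_le_1[OF that(1)] that k False by fastforce
  moreover have "sample_bound n k \<delta> \<ge> 0" by (simp add: sample_bound_def Let_def)
  ultimately show ?thesis
    by (intro exI[of _ 0] exI[of _ "\<lambda>S E. return_pmf True"]) auto
next
  case True
  define x \<Lambda> where "x = real n / (\<delta>\<^sup>2 * real k)" and "\<Lambda> = 1 + ln x"
  have "\<delta>\<^sup>2 \<le> 1" using \<delta> True by (simp add: power_le_one)
  then have "\<delta>\<^sup>2 * real k \<le> 1 * real k" by (intro mult_right_mono) auto
  then have "\<delta>\<^sup>2 * real k \<le> n" using k by linarith
  then have x1: "x \<ge> 1" unfolding x_def using \<delta> k by simp
  then have \<Lambda>1: "\<Lambda> \<ge> 1" by (simp add: \<Lambda>_def)
  \<comment> \<open>Rounding up at most doubles a number that is at least 1, whence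
    \<open>2 ^ 24\<close> in the upper bound.\<close>
  define s where "s = nat \<lceil>2 ^ 23 * (x * \<Lambda> ^ 3)\<rceil>"
  have x\<Lambda>: "1 \<le> x * \<Lambda> ^ 3" using mult_mono[of 1 x 1 "\<Lambda> ^ 3"] x1 \<Lambda>1 by simp
  have s_bounds: "2 ^ 23 * (x * \<Lambda> ^ 3) \<le> s" "s \<le> 2 ^ 24 * (x * \<Lambda> ^ 3)"
  proof -
    have "real s = of_int \<lceil>2 ^ 23 * (x * \<Lambda> ^ 3)\<rceil>" unfolding s_def using x\<Lambda> by simp
    moreover have "1 \<le> 2 ^ 23 * (x * \<Lambda> ^ 3)" using x\<Lambda> by simp
    moreover have "of_int \<lceil>2 ^ 23 * (x * \<Lambda> ^ 3)\<rceil> \<le> 2 ^ 23 * (x * \<Lambda> ^ 3) + 1"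
      by (rule of_int_ceiling_le_add_one)
    ultimately have "real s \<le> 2 * (2 ^ 23 * (x * \<Lambda> ^ 3))" by linarith
    then show "s \<le> 2 ^ 24 * (x * \<Lambda> ^ 3)" by simp
    show "2 ^ 23 * (x * \<Lambda> ^ 3) \<le> s" unfolding s_def by linarith
  qed
  have s_bound: "real s \<le> 24 * 2 ^ 24 * sample_bound n k \<delta>"
    using s_bounds(2) shifted_ln_cube_le[OF x1] by (simp add: sample_bound_def Let_def x_def \<Lambda>_def)
  show ?thesis
  proof (cases "s \<le> n")
    case s: True
    define \<eta> \<mu> where "\<eta> = \<delta> / (576 * \<Lambda>)" and "\<mu> = real s * k / n"
    have \<eta>: "\<eta> > 0" using \<delta> \<Lambda>1 by (simp add: \<eta>_def)
    have "real s / (x * \<delta>\<^sup>2) = \<mu>" using k \<delta> by (simp add: x_def \<mu>_def)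
    moreover have "2 ^ 23 * (x * \<Lambda> ^ 3) / (x * \<delta>\<^sup>2) \<le> s / (x * \<delta>\<^sup>2)"
      using s_bounds x1 by (intro divide_right_mono) auto
    ultimately have \<mu>: "2 ^ 23 * \<Lambda> ^ 3 / \<delta>\<^sup>2 \<le> \<mu>" using x1 by simp
    \<comment> \<open>The deviation \<open>\<eta>\<close> is dictated by the container gain;
      \<open>2 ^ 23\<close> is large enough to make it visible to Chebyshev as well.\<close>
    have "2 \<le> 2 ^ 23 / 576\<^sup>2 * \<Lambda>" using \<Lambda>1 by simp
    also have "\<dots> = \<eta>\<^sup>2 * (2 ^ 23 * \<Lambda> ^ 3 / \<delta>\<^sup>2)"
      unfolding \<eta>_def using \<delta> \<Lambda>1 by (simp add: field_simps power2_eq_square power3_eq_cube)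
    also have "\<dots> \<le> \<eta>\<^sup>2 * \<mu>" using \<mu> by (intro mult_left_mono) auto
    finally have \<eta>\<mu>: "2 \<le> \<eta>\<^sup>2 * \<mu>" .
    have "0 < 2 ^ 23 * \<Lambda> ^ 3 / \<delta>\<^sup>2" using \<delta> \<Lambda>1 by simp
    then have \<mu>0: "\<mu> > 0" using \<mu> by linarith
    show ?thesis
    proof (intro exI conjI allI impI)
      fix V and E :: "'a set set" assume G: "simple_graph V E \<and> card V = n"
      show "acceptance_prob (\<lambda>S E. return_pmf (large_clique_test ((1 - \<eta>) * \<mu>) S E)) s V E \<ge> 1 / 2"
        if "has_clique V E k"
        using that G s \<mu>0 \<eta> \<eta>\<mu> k by (intro acceptance_prob_clique_ge) (auto simp: \<mu>_def)
      show "acceptance_prob (\<lambda>S E. return_pmf (large_clique_test ((1 - \<eta>) * \<mu>) S E)) s V E \<le> 3 / 8"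
        if "sparse_subgraphs V E k \<delta>"
        using acceptance_prob_sparse_le[of V E k \<delta> s x \<Lambda>] that G s k \<delta> True s_bounds
        by (simp add: \<eta>_def \<mu>_def x_def \<Lambda>_def)
    qed (use s s_bound in auto)
  next
    case s: False
    \<comment> \<open>The sample has \<open>n\<close> vertices here; \<open>n < s\<close> keeps it
      within the bound proved for \<open>s\<close>.\<close>
    show ?thesis
    proof (intro exI conjI allI impI)
      fix V and E :: "'a set set" assume G: "simple_graph V E \<and> card V = n"
      then have eq: "acceptance_prob (\<lambda>S E. return_pmf (has_clique S E k)) n V E = of_bool (has_clique V E k)"
        using acceptance_prob_whole_graph by blast
      show "acceptance_prob (\<lambda>S E. return_pmf (has_clique S E k)) n V E \<ge> 1 / 2" if "has_clique V E k"
        using that eq by simp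
      show "acceptance_prob (\<lambda>S E. return_pmf (has_clique S E k)) n V E \<le> 3 / 8"
        if "sparse_subgraphs V E k \<delta>"
        using sparse_subgraphs_no_clique[of V E k \<delta>] that G k \<delta> eq by simp
    qed (use s s_bound in auto)
  qed
qed

text \<open>For \<open>k < 2\<close> the number \<open>k choose 2\<close> is 0 and every graph on
  more than \<open>k\<close> vertices is of both types, whence \<open>2 \<le> k\<close>.\<close>

theorem theorem1:
  shows "\<exists>(C::real) (\<delta>\<^sub>1::real) (\<delta>\<^sub>2::real). C > 0 \<and> \<delta>\<^sub>1 > \<delta>\<^sub>2 \<and>
    (\<forall>(n::nat) (k::nat) (\<delta>::real). 2 \<le> k \<and> k < n \<and> \<delta> > 0 \<longrightarrow>
      (\<exists>(s::nat) (A :: nat sample_algorithm).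
         s \<le> n \<and> real s \<le> C * sample_bound n k \<delta> \<and>
         (\<forall>V E. simple_graph V E \<and> card V = n \<longrightarrow>
            (has_clique V E k \<longrightarrow> acceptance_prob A s V E \<ge> \<delta>\<^sub>1) \<and>
            (sparse_subgraphs V E k \<delta> \<longrightarrow> acceptance_prob A s V E \<le> \<delta>\<^sub>2))))"
  by (rule exI[of _ "24 * 2 ^ 24"], rule exI[of _ "1 / 2"], rule exI[of _ "3 / 8"])
     (intro conjI allI impI distinguishing_algorithm_exists; simp)

end
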